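(* Let $(G,\tau,\partial)$ be a Polish topometric group with ample generics. Let $k_n\in G$ and $A_n\subseteq G$ for $n\in\mathbb N$ be such that $\bigcup_{n\in\mathbb N}k_nA_n$ is co-meagre in $G$. Then there is some $n$ such that for all $\varepsilon>0$, $$1_G\in\mathrm{Int}_\tau\Big(\big(A_n^{-1}A_nA_n^{-1}A_n^{-1}A_nA_n^{-1}A_nA_nA_n^{-1}A_n\big)_\varepsilon\Big).$$
   Context: A Polish topometric group is a triple $(G,\tau,\partial)$ with $(G,\tau)$ a Polish group, $\partial$ a bi-invariant metric whose topology refines $\tau$ and which is $\tau$-lower semi-continuous. For $A\subseteq G$, $(A)_\varepsilon=\{g\colon\partial(g,A)<\varepsilon\}$. $G^n$ has the product topology and supremum metric, and $G$ acts on $G^n$ by diagonal conjugation. $(G,\tau,\partial)$ has ample generics if for all $n\in\mathbb N$ and $\varepsilon>0$ there is $\bar g\in G^n$ with $(\{(kg_0k^{-1},\dots,kg_{n-1}k^{-1})\colon k\in G\})_\varepsilon$ co-meagre in $G^n$. Products $A_n^{-1}A_n\cdots$ denote sets of products of elements. *)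

theory Defs
  imports "HOL-Analysis.Analysis" "HOL-Algebra.Coset"
begin

definition Polish_space :: "'a topology \<Rightarrow> bool" where
  "Polish_space Y \<longleftrightarrow> completely_metrizable_space Y \<and> separable_space Y"

definition Polish_group :: "('a, 'b) monoid_scheme \<Rightarrow> 'a topology \<Rightarrow> bool" where
  "Polish_group G T \<longleftrightarrow> group G \<and> topspace T = carrier G \<and> Polish_space T
     \<and> continuous_map (prod_topology T T) T (\<lambda>(x, y). x \<otimes>\<^bsub>G\<^esub> y)
     \<and> continuous_map T T (\<lambda>x. inv\<^bsub>G\<^esub> x)"

definition Polish_topometric_group ::
  "('a, 'b) monoid_scheme \<Rightarrow> 'a topology \<Rightarrow> ('a \<Rightarrow> 'a \<Rightarrow> real) \<Rightarrow> bool" where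
  "Polish_topometric_group G T d \<longleftrightarrow> Polish_group G T
     \<and> Metric_space (carrier G) d
     \<and> (\<forall>g\<in>carrier G. \<forall>h\<in>carrier G. \<forall>x\<in>carrier G. \<forall>y\<in>carrier G.
          d (g \<otimes>\<^bsub>G\<^esub> x \<otimes>\<^bsub>G\<^esub> h) (g \<otimes>\<^bsub>G\<^esub> y \<otimes>\<^bsub>G\<^esub> h) = d x y)
     \<and> (\<forall>U. openin T U \<longrightarrow> openin (Metric_space.mtopology (carrier G) d) U)
     \<and> (\<forall>r::real. openin (prod_topology T T) {(x, y) \<in> carrier G \<times> carrier G. r < d x y})"

definition nowhere_dense_in :: "'a topology \<Rightarrow> 'a set \<Rightarrow> bool" where
  "nowhere_dense_in X S \<longleftrightarrow> X interior_of (X closure_of S) = {}"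

definition meagre_in :: "'a topology \<Rightarrow> 'a set \<Rightarrow> bool" where
  "meagre_in X S \<longleftrightarrow> (\<exists>F :: nat \<Rightarrow> 'a set. (\<forall>i. nowhere_dense_in X (F i)) \<and> S \<subseteq> (\<Union>i. F i))"

definition comeagre_in :: "'a topology \<Rightarrow> 'a set \<Rightarrow> bool" where
  "comeagre_in X S \<longleftrightarrow> S \<subseteq> topspace X \<and> meagre_in X (topspace X - S)"

text \<open>G^n: tuples modelled as extensional functions on {..<n}, product topology,
  supremum metric.\<close>
definition tuples_top :: "'a topology \<Rightarrow> nat \<Rightarrow> (nat \<Rightarrow> 'a) topology" where
  "tuples_top T n = product_topology (\<lambda>_. T) {..<n}"

definition sup_dist :: "('a \<Rightarrow> 'a \<Rightarrow> real) \<Rightarrow> nat \<Rightarrow> (nat \<Rightarrow> 'a) \<Rightarrow> (nat \<Rightarrow> 'a) \<Rightarrow> real" where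
  "sup_dist d n x y = (if n = 0 then 0 else Max ((\<lambda>i. d (x i) (y i)) ` {..<n}))"

text \<open>(A)_eps = {x. dist(x, A) < eps}, where dist(x,A) = inf of dist(x,a), a in A.\<close>
definition eps_nbhd :: "'a set \<Rightarrow> ('a \<Rightarrow> 'a \<Rightarrow> real) \<Rightarrow> 'a set \<Rightarrow> real \<Rightarrow> 'a set" where
  "eps_nbhd M d A e = {x \<in> M. \<exists>a\<in>A. d x a < e}"

definition conj_orbit :: "('a, 'b) monoid_scheme \<Rightarrow> nat \<Rightarrow> (nat \<Rightarrow> 'a) \<Rightarrow> (nat \<Rightarrow> 'a) set" where
  "conj_orbit G n g = {(\<lambda>i\<in>{..<n}. k \<otimes>\<^bsub>G\<^esub> g i \<otimes>\<^bsub>G\<^esub> inv\<^bsub>G\<^esub> k) | k. k \<in> carrier G}"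

definition ample_generics ::
  "('a, 'b) monoid_scheme \<Rightarrow> 'a topology \<Rightarrow> ('a \<Rightarrow> 'a \<Rightarrow> real) \<Rightarrow> bool" where
  "ample_generics G T d \<longleftrightarrow> (\<forall>n::nat. \<forall>e>0. \<exists>g \<in> topspace (tuples_top T n).
      comeagre_in (tuples_top T n)
        (eps_nbhd (topspace (tuples_top T n)) (sup_dist d n) (conj_orbit G n g) e))"

end

theory Submission
  imports Defs
begin

text \<open>
  Suppose that the conclusion fails for every \<open>n\<close>, with a witness \<open>e n\<close>, and discard the meagre
  \<open>A n\<close>. Where \<open>A n\<close> is everywhere nonmeagre, so is the set \<open>Y n\<close> of elements at distance at least
  \<open>e n\<close> from all conjugates of elements of \<open>A n\<close> by elements of the form \<open>\<beta>\<^sup>-\<^sup>1 \<alpha>\<close> with \<open>\<alpha>, \<beta> \<in> A n\<close>.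
  Ample generics yield a Cantor set of elements \<open>h a\<close> such that whenever \<open>a\<close> and \<open>b\<close> split at level
  \<open>m\<close>, a conjugate by \<open>h a\<close> of an element of \<open>A n\<close> is within \<open>e n\<close> of a conjugate by \<open>h b\<close> of an
  element of \<open>Y n\<close>, where \<open>n = \<sigma> m\<close> runs through all indices infinitely often. After a left
  translation almost every \<open>h a\<close> lies in some \<open>k n A n\<close>, so by the Baire category theorem there are
  \<open>a\<close> and \<open>b\<close> with the same \<open>n\<close> that split at a level \<open>m\<close> with \<open>\<sigma> m = n\<close>. Then
  \<open>(h b)\<^sup>-\<^sup>1 (h a)\<close> is of the form \<open>\<beta>\<^sup>-\<^sup>1 \<alpha>\<close>, which contradicts the definition of \<open>Y n\<close>.
\<close>

section \<open>Baire category\<close>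

text \<open>The sets \<open>A n\<close> are arbitrary and need not have the Baire property, so they
  cannot be replaced by open sets modulo meagre ones. What replaces this is that a nonmeagre subset
  of the space meets every comeagre set; hence the recurring condition of being nonmeagre in every
  nonempty open subset of some open set. \<open>A n\<close> and \<open>Y n\<close> enter
  differently: \<open>x\<close> in \<open>A n\<close> is chosen first, and \<open>y\<close> in
  \<open>Y n\<close> must then be found in a neighbourhood that depends on \<open>x\<close>.

  Ample generics give no comeagre orbit here, only for each thickness an orbit whose thickening is
  comeagre, so every conjugacy is approximate. Bi-invariance of \<open>d\<close> makes conjugation
  isometric, so errors add up but do not grow, and lower semicontinuity carries non-strict bounds
  through limits in \<open>T\<close>, for which \<open>d\<close> need not be continuous.

  Pairs of branches are compared because a single \<open>h a\<close> is located only up to the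
  factor \<open>k n\<close> and the left translation; both cancel in a quotient of two elements with
  the same \<open>n\<close>.\<close>

lemma meagre_in_subset: "meagre_in X S \<Longrightarrow> S' \<subseteq> S \<Longrightarrow> meagre_in X S'"
  unfolding meagre_in_def by blast

lemma nowhere_dense_imp_meagre: "nowhere_dense_in X S \<Longrightarrow> meagre_in X S"
  unfolding meagre_in_def by (rule exI[of _ "\<lambda>_. S"]) auto

lemma meagre_in_empty: "meagre_in X {}"
  by (rule nowhere_dense_imp_meagre) (simp add: nowhere_dense_in_def)

lemma meagre_in_UN_nat:
  fixes S :: "nat \<Rightarrow> 'a set"
  assumes "\<And>i. meagre_in X (S i)"
  shows "meagre_in X (\<Union>i. S i)"
proof -
  obtain F :: "nat \<Rightarrow> nat \<Rightarrow> 'a set"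
    where F: "\<And>i j. nowhere_dense_in X (F i j)" "\<And>i. S i \<subseteq> (\<Union>j. F i j)"
    using assms unfolding meagre_in_def by metis
  have "(\<Union>i. S i) \<subseteq> (\<Union>m. case_prod F (prod_decode m))"
  proof
    fix x assume "x \<in> (\<Union>i. S i)"
    then obtain i j where "x \<in> F i j" using F(2) by blast
    then have "x \<in> case_prod F (prod_decode (prod_encode (i, j)))" by simp
    then show "x \<in> (\<Union>m. case_prod F (prod_decode m))" by (rule UN_I[OF UNIV_I])
  qed
  moreover have "nowhere_dense_in X (case_prod F (prod_decode m))" for m
    using F(1) by (simp add: split_def)
  ultimately show ?thesis unfolding meagre_in_def
    by (intro exI[of _ "\<lambda>m. case_prod F (prod_decode m)"]) (rule conjI, rule allI)
qed

lemma meagre_in_UN: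
  assumes "countable I" "\<And>i. i \<in> I \<Longrightarrow> meagre_in X (S i)"
  shows "meagre_in X (\<Union>i\<in>I. S i)"
proof (cases "I = {}")
  case False
  with assms(1) have "(\<Union>i\<in>I. S i) = (\<Union>m. S (from_nat_into I m))"
    by (metis UN_extend_simps(10) range_from_nat_into)
  then show ?thesis
    using meagre_in_UN_nat[of X "\<lambda>m. S (from_nat_into I m)"] assms(2) False
    by (simp add: from_nat_into)
qed (simp add: meagre_in_empty)

lemma meagre_in_Un: "meagre_in X S \<Longrightarrow> meagre_in X S' \<Longrightarrow> meagre_in X (S \<union> S')"
  using meagre_in_UN[of "{S, S'}" X id] by auto

lemma nowhere_dense_closed_complement:
  assumes "openin X D" "X closure_of D = topspace X"
  shows "nowhere_dense_in X (topspace X - D)"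
  using assms by (simp add: nowhere_dense_in_def closure_of_complement interior_of_openin interior_of_complement)

lemma comeagre_in_superset:
  "comeagre_in X S \<Longrightarrow> S \<subseteq> S' \<Longrightarrow> S' \<subseteq> topspace X \<Longrightarrow> comeagre_in X S'"
  unfolding comeagre_in_def by (meson Diff_mono meagre_in_subset order_refl)

lemma comeagre_in_dense_open:
  "openin X D \<Longrightarrow> X closure_of D = topspace X \<Longrightarrow> comeagre_in X D"
  by (simp add: comeagre_in_def openin_subset nowhere_dense_imp_meagre nowhere_dense_closed_complement)

lemma comeagre_in_INT:
  assumes "countable I" "\<And>i. i \<in> I \<Longrightarrow> comeagre_in X (S i)"
  shows "comeagre_in X (topspace X \<inter> (\<Inter>i\<in>I. S i))"
proof -
  have "topspace X - topspace X \<inter> (\<Inter>i\<in>I. S i) = (\<Union>i\<in>I. topspace X - S i)" by auto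
  then show ?thesis
    using meagre_in_UN[OF assms(1), of X "\<lambda>i. topspace X - S i"] assms(2)
    by (simp add: comeagre_in_def)
qed

lemma comeagre_in_Int:
  "comeagre_in X S \<Longrightarrow> comeagre_in X S' \<Longrightarrow> comeagre_in X (S \<inter> S')"
  unfolding comeagre_in_def by (auto simp: Diff_Int intro: meagre_in_Un)

text \<open>Complements of closures of nowhere dense sets are dense and open. In this form a
  comeagre set can be sliced and pulled back along continuous maps.\<close>

lemma comeagre_in_iff_dense_open:
  "comeagre_in X S \<longleftrightarrow> S \<subseteq> topspace X \<and>
    (\<exists>D :: nat \<Rightarrow> 'a set. (\<forall>i. openin X (D i) \<and> X closure_of D i = topspace X)
        \<and> topspace X \<inter> (\<Inter>i. D i) \<subseteq> S)" (is "?L = ?R")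
proof
  assume L: ?L
  then obtain F :: "nat \<Rightarrow> 'a set"
    where F: "\<And>i. nowhere_dense_in X (F i)" "topspace X - S \<subseteq> (\<Union>i. F i)"
    unfolding comeagre_in_def meagre_in_def by blast
  define D where "D i = topspace X - X closure_of (F i)" for i
  have "openin X (D i) \<and> X closure_of D i = topspace X" for i
    using F(1)[of i] by (simp add: D_def nowhere_dense_in_def closure_of_complement openin_diff)
  moreover have "topspace X \<inter> (\<Inter>i. D i) \<subseteq> S"
  proof
    fix x assume x: "x \<in> topspace X \<inter> (\<Inter>i. D i)"
    have "x \<notin> F i" for i
    proof
      assume "x \<in> F i"
      then have "x \<in> X closure_of F i"
        using x closure_of_subset_Int[of X "F i"] by blast
      then show False using x by (auto simp: D_def)
    qed
    then show "x \<in> S" using x F(2) by blast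
  qed
  ultimately show ?R using L unfolding comeagre_in_def by blast
next
  assume R: ?R
  then obtain D :: "nat \<Rightarrow> 'a set"
    where D: "\<And>i. openin X (D i)" "\<And>i. X closure_of D i = topspace X"
      "topspace X \<inter> (\<Inter>i. D i) \<subseteq> S" by blast
  then have "comeagre_in X (topspace X \<inter> (\<Inter>i. D i))"
    by (intro comeagre_in_INT) (auto intro: comeagre_in_dense_open)
  then show ?L using comeagre_in_superset D(3) R by blast
qed

lemma meagre_interior_empty:
  assumes "completely_metrizable_space X" "meagre_in X S"
  shows "X interior_of S = {}"
proof -
  obtain F :: "nat \<Rightarrow> 'a set"
    where F: "\<And>i. nowhere_dense_in X (F i)" "S \<subseteq> (\<Union>i. F i)"
    using assms(2) unfolding meagre_in_def by blast
  have "X interior_of \<Union>(range (\<lambda>i. X closure_of F i)) = {}"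
    by (rule Baire_category_alt) (use assms F(1) in \<open>auto simp: nowhere_dense_in_def\<close>)
  moreover have "topspace X \<inter> S \<subseteq> \<Union>(range (\<lambda>i. X closure_of F i))"
  proof
    fix x assume "x \<in> topspace X \<inter> S"
    then obtain i where "x \<in> topspace X \<inter> F i" using F(2) by blast
    then show "x \<in> \<Union>(range (\<lambda>i. X closure_of F i))"
      using closure_of_subset_Int[of X "F i"] by blast
  qed
  ultimately show ?thesis
    by (metis interior_of_mono interior_of_restrict subset_empty)
qed

lemma comeagre_meets_open:
  assumes "completely_metrizable_space X" "comeagre_in X S" "openin X U" "U \<noteq> {}"
  shows "S \<inter> U \<noteq> {}"
proof
  assume "S \<inter> U = {}"
  then have "U \<subseteq> topspace X - S" using openin_subset[OF assms(3)] by auto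
  then have "U \<subseteq> X interior_of (topspace X - S)" using assms(3) interior_of_maximal by blast
  then show False
    using meagre_interior_empty[OF assms(1), of "topspace X - S"] assms(2,4)
    by (auto simp: comeagre_in_def)
qed

text \<open>This is how generic points are found inside sets that may lack the Baire
  property.\<close>

lemma comeagre_Int_nonmeagre:
  assumes "comeagre_in X S" "\<not> meagre_in X B" "B \<subseteq> topspace X"
  shows "\<not> meagre_in X (B \<inter> S)"
proof
  assume "meagre_in X (B \<inter> S)"
  then have "meagre_in X ((B \<inter> S) \<union> (topspace X - S))"
    using assms(1) by (simp add: comeagre_in_def meagre_in_Un)
  moreover have "B \<subseteq> (B \<inter> S) \<union> (topspace X - S)" using assms(3) by blast
  ultimately show False using assms(2) meagre_in_subset by blast
qed

lemma meagre_in_homeomorphic_image: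
  assumes f: "homeomorphic_map X Y f" and S: "meagre_in X S" "S \<subseteq> topspace X"
  shows "meagre_in Y (f ` S)"
proof -
  obtain F :: "nat \<Rightarrow> 'a set"
    where F: "\<And>i. nowhere_dense_in X (F i)" "S \<subseteq> (\<Union>i. F i)"
    using S unfolding meagre_in_def by blast
  \<comment> \<open>\<open>F i\<close> may contain points outside the space, where nothing is known
    about \<open>f\<close>; hence the intersection.\<close>
  have "nowhere_dense_in Y (f ` (topspace X \<inter> F i))" for i
    using F(1)[of i] closure_of_restrict[of X "F i"]
    by (simp add: nowhere_dense_in_def homeomorphic_map_closure_of[OF f]
        homeomorphic_map_interior_of[OF f] closure_of_subset_topspace)
  moreover have "f ` S \<subseteq> (\<Union>i. f ` (topspace X \<inter> F i))" using F(2) S(2) by blast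
  ultimately show ?thesis unfolding meagre_in_def by (intro exI[of _ "\<lambda>i. f ` (topspace X \<inter> F i)"]) simp
qed

lemma comeagre_in_homeomorphic_image:
  assumes f: "homeomorphic_map X Y f" and S: "comeagre_in X S"
  shows "comeagre_in Y (f ` S)"
proof -
  have "topspace Y - f ` S = f ` (topspace X - S)"
    using f S unfolding homeomorphic_eq_everything_map comeagre_in_def
    by (metis Diff_subset inj_on_image_set_diff order_refl)
  then show ?thesis
    using meagre_in_homeomorphic_image[OF f, of "topspace X - S"] S
      homeomorphic_imp_surjective_map[OF f] unfolding comeagre_in_def by (metis Diff_subset image_mono)
qed

text \<open>Weaker than second countability: the members inside an open set need not cover it.\<close>

definition has_countable_pi_base :: "'a topology \<Rightarrow> bool" where
  "has_countable_pi_base X \<longleftrightarrow> (\<exists>\<B>. countable \<B> \<and> (\<forall>V\<in>\<B>. openin X V \<and> V \<noteq> {})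
     \<and> (\<forall>U. openin X U \<and> U \<noteq> {} \<longrightarrow> (\<exists>V\<in>\<B>. V \<subseteq> U)))"

lemma has_countable_pi_baseI:
  assumes "\<And>U. openin X U \<Longrightarrow> U \<noteq> {} \<Longrightarrow> \<exists>V\<in>\<B>. V \<subseteq> U"
    and "\<And>V. V \<in> \<B> \<Longrightarrow> openin X V \<and> V \<noteq> {}" and "countable \<B>"
  shows "has_countable_pi_base X"
  unfolding has_countable_pi_base_def using assms by (intro exI[of _ \<B>] conjI ballI allI impI) metis+

lemma has_countable_pi_base_metrizable:
  assumes "metrizable_space X" "separable_space X"
  shows "has_countable_pi_base X"
proof -
  obtain M d where Md: "Metric_space M d" "X = Metric_space.mtopology M d"
    using assms(1) unfolding metrizable_space_def by blast
  interpret Metric_space M d by fact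
  obtain C where C: "countable C" "C \<subseteq> M" "mtopology closure_of C = M"
    using assms(2) Md(2) unfolding separable_space_def by auto
  define \<B> where "\<B> = (\<lambda>(c, n :: nat). mball c (1 / real (Suc n))) ` (C \<times> UNIV)"
  have "\<exists>V\<in>\<B>. V \<subseteq> U" if U: "openin mtopology U" "U \<noteq> {}" for U
  proof -
    obtain u where u: "u \<in> U" using U by blast
    then obtain r where r: "r > 0" "mball u r \<subseteq> U" "u \<in> M"
      using U(1) unfolding openin_mtopology by blast
    obtain n :: nat where n: "1 / real (Suc n) < r / 2"
      using nat_approx_posE[of "r/2"] r(1) by (auto simp del: of_nat_Suc)
    obtain c where c: "c \<in> C" "c \<in> mball u (1 / real (Suc n))"
      using C(3) dense_intersects_open[of mtopology C] r(3)
      by (metis centre_in_mball_iff disjoint_iff empty_iff of_nat_0_less_iff openin_mball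
          topspace_mtopology zero_less_Suc zero_less_divide_1_iff)
    have "mball c (1 / real (Suc n)) \<subseteq> mball u r"
    proof
      fix x assume x: "x \<in> mball c (1 / real (Suc n))"
      then have "d u x \<le> d u c + d c x" using c by (intro triangle) auto
      also have "\<dots> < r" using x c n by auto
      finally show "x \<in> mball u r" using x r(3) by simp
    qed
    then show ?thesis using c r unfolding \<B>_def by (force simp del: of_nat_Suc)
  qed
  moreover have "openin mtopology V \<and> V \<noteq> {}" if "V \<in> \<B>" for V
    using that C(2) unfolding \<B>_def
    by (auto simp del: of_nat_Suc) (metis centre_in_mball_iff empty_iff in_mono of_nat_0_less_iff zero_less_Suc zero_less_divide_1_iff)
  moreover have "countable \<B>" unfolding \<B>_def using C(1) by simp
  ultimately show ?thesis unfolding Md(2) by (rule has_countable_pi_baseI)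
qed

lemma has_countable_pi_base_homeomorphic:
  assumes f: "homeomorphic_map X Y f" and "has_countable_pi_base X"
  shows "has_countable_pi_base Y"
proof -
  obtain \<B> where B: "countable \<B>" "\<And>V. V \<in> \<B> \<Longrightarrow> openin X V \<and> V \<noteq> {}"
    "\<And>U. openin X U \<Longrightarrow> U \<noteq> {} \<Longrightarrow> \<exists>V\<in>\<B>. V \<subseteq> U"
    using assms(2) unfolding has_countable_pi_base_def by metis
  have "\<exists>V\<in>(`) f ` \<B>. V \<subseteq> U" if U: "openin Y U" "U \<noteq> {}" for U
  proof -
    have "openin X {x \<in> topspace X. f x \<in> U}"
      using f U(1) homeomorphic_imp_continuous_map openin_continuous_map_preimage by blast
    moreover have "{x \<in> topspace X. f x \<in> U} \<noteq> {}"
    proof -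
      obtain y where y: "y \<in> U" "y \<in> topspace Y" using U openin_subset[OF U(1)] by auto
      then obtain x where "x \<in> topspace X" "f x = y"
        using homeomorphic_imp_surjective_map[OF f] by (metis imageE)
      then show ?thesis using y by blast
    qed
    ultimately obtain V where "V \<in> \<B>" "V \<subseteq> {x \<in> topspace X. f x \<in> U}"
      using B(3) by meson
    then show ?thesis by (intro bexI[of _ "f ` V"]) auto
  qed
  moreover have "openin Y V \<and> V \<noteq> {}" if "V \<in> (`) f ` \<B>" for V
    using that B(2) f homeomorphic_imp_open_map open_map_def by fastforce
  moreover have "countable ((`) f ` \<B>)" using B(1) by simp
  ultimately show ?thesis by (rule has_countable_pi_baseI)
qed

lemma has_countable_pi_base_prod:
  assumes "has_countable_pi_base X" "has_countable_pi_base Y"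
  shows "has_countable_pi_base (prod_topology X Y)"
proof -
  obtain \<B> where B: "countable \<B>" "\<And>V. V \<in> \<B> \<Longrightarrow> openin X V \<and> V \<noteq> {}"
    "\<And>U. openin X U \<Longrightarrow> U \<noteq> {} \<Longrightarrow> \<exists>V\<in>\<B>. V \<subseteq> U"
    using assms(1) unfolding has_countable_pi_base_def by metis
  obtain \<C> where C: "countable \<C>" "\<And>V. V \<in> \<C> \<Longrightarrow> openin Y V \<and> V \<noteq> {}"
    "\<And>U. openin Y U \<Longrightarrow> U \<noteq> {} \<Longrightarrow> \<exists>V\<in>\<C>. V \<subseteq> U"
    using assms(2) unfolding has_countable_pi_base_def by metis
  let ?D = "(\<lambda>(V, W). V \<times> W) ` (\<B> \<times> \<C>)"
  have "\<exists>V\<in>?D. V \<subseteq> U" if U: "openin (prod_topology X Y) U" "U \<noteq> {}" for U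
  proof -
    obtain x y where "(x, y) \<in> U" using U(2) by auto
    then obtain V W where VW: "openin X V" "openin Y W" "x \<in> V" "y \<in> W" "V \<times> W \<subseteq> U"
      using U(1) unfolding openin_prod_topology_alt by metis
    obtain V' where V': "V' \<in> \<B>" "V' \<subseteq> V" using VW(3) B(3)[OF VW(1)] by auto
    obtain W' where W': "W' \<in> \<C>" "W' \<subseteq> W" using VW(4) C(3)[OF VW(2)] by auto
    have "V' \<times> W' \<in> ?D" using V' W' by force
    moreover have "V' \<times> W' \<subseteq> U" using V'(2) W'(2) VW(5) by blast
    ultimately show ?thesis by (rule bexI[rotated])
  qed
  moreover have "openin (prod_topology X Y) V \<and> V \<noteq> {}" if "V \<in> ?D" for V
    using that B(2) C(2) by (auto simp: openin_prod_Times_iff)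
  moreover have "countable ?D" using B(1) C(1) by simp
  ultimately show ?thesis by (rule has_countable_pi_baseI)
qed

text \<open>Let \<open>M\<close> be the union of the basic open sets in which \<open>B\<close> is
  meagre, and \<open>U\<close> the complement of its closure. By countability \<open>B\<close> is
  meagre in \<open>M\<close>, and the frontier of \<open>M\<close> is nowhere dense. No regularity
  of \<open>B\<close> enters, which is what makes the lemma applicable to the sets
  \<open>A n\<close>.\<close>

lemma nonmeagre_locus:
  assumes "has_countable_pi_base X" "B \<subseteq> topspace X"
  obtains U where "openin X U" "meagre_in X (B - U)"
    "\<And>V. openin X V \<Longrightarrow> V \<noteq> {} \<Longrightarrow> V \<subseteq> U \<Longrightarrow> \<not> meagre_in X (B \<inter> V)"
proof -
  obtain \<B> where \<B>: "countable \<B>" "\<And>V. V \<in> \<B> \<Longrightarrow> openin X V \<and> V \<noteq> {}"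
    "\<And>U. openin X U \<Longrightarrow> U \<noteq> {} \<Longrightarrow> \<exists>V\<in>\<B>. V \<subseteq> U"
    using assms(1) unfolding has_countable_pi_base_def by metis
  define M where "M = \<Union>{V \<in> \<B>. meagre_in X (B \<inter> V)}"
  have Mo: "openin X M" unfolding M_def using \<B>(2) by blast
  define U where "U = topspace X - X closure_of M"
  have "nowhere_dense_in X (X closure_of M - M)"
  proof -
    have "closedin X (X closure_of M - M)" using Mo by (simp add: closedin_diff)
    moreover have "X interior_of (X closure_of M - M) = {}"
      unfolding interior_of_eq_empty
    proof clarify
      fix T assume T: "openin X T" "T \<subseteq> X closure_of M - M"
      then have "T \<inter> X closure_of M = {}" using openin_Int_closure_of_eq_empty[OF T(1), of M] by blast
      then show "T = {}" using T(2) by blast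
    qed
    ultimately show ?thesis by (simp add: nowhere_dense_in_def closure_of_closedin)
  qed
  moreover have "meagre_in X (\<Union>V\<in>{V \<in> \<B>. meagre_in X (B \<inter> V)}. B \<inter> V)"
    using \<B>(1) by (intro meagre_in_UN) auto
  ultimately have "meagre_in X ((X closure_of M - M) \<union> (\<Union>V\<in>{V \<in> \<B>. meagre_in X (B \<inter> V)}. B \<inter> V))"
    by (simp only: meagre_in_Un nowhere_dense_imp_meagre)
  moreover have "B - U \<subseteq> (X closure_of M - M) \<union> (\<Union>V\<in>{V \<in> \<B>. meagre_in X (B \<inter> V)}. B \<inter> V)"
    using assms(2) unfolding U_def M_def by blast
  ultimately have "meagre_in X (B - U)" using meagre_in_subset by blast
  moreover have "\<not> meagre_in X (B \<inter> V)" if V: "openin X V" "V \<noteq> {}" "V \<subseteq> U" for V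
  proof
    assume m: "meagre_in X (B \<inter> V)"
    obtain V' where V': "V' \<in> \<B>" "V' \<subseteq> V" using \<B>(3) V by blast
    then have "meagre_in X (B \<inter> V')" using m meagre_in_subset by (metis Int_mono order_refl)
    then have "V' \<subseteq> M" using V'(1) unfolding M_def by blast
    then have "V' \<subseteq> X closure_of M" using closure_of_subset[OF openin_subset[OF Mo]] by blast
    then show False using V V' \<B>(2)[OF V'(1)] unfolding U_def by blast
  qed
  moreover have "openin X U" by (simp add: U_def openin_diff)
  ultimately show ?thesis using that by blast
qed

text \<open>For a dense open set \<open>D i\<close> and a basic \<open>V\<close>, the points
  \<open>x\<close> whose section of \<open>D i\<close> meets \<open>V\<close> form a dense open set.
  Density of a section need only be tested on the countably many members of a pi-base of
  \<open>Y\<close>, so almost every \<open>x\<close> passes all tests.\<close>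

lemma Kuratowski_Ulam:
  assumes Y: "has_countable_pi_base Y" and S: "comeagre_in (prod_topology X Y) S"
  shows "comeagre_in X {x \<in> topspace X. comeagre_in Y {y \<in> topspace Y. (x, y) \<in> S}}"
proof -
  obtain \<B> where \<B>: "countable \<B>" "\<And>V. V \<in> \<B> \<Longrightarrow> openin Y V \<and> V \<noteq> {}"
    "\<And>U. openin Y U \<Longrightarrow> U \<noteq> {} \<Longrightarrow> \<exists>V\<in>\<B>. V \<subseteq> U"
    using Y unfolding has_countable_pi_base_def by metis
  obtain D :: "nat \<Rightarrow> _" where D: "\<And>i. openin (prod_topology X Y) (D i)"
     "\<And>i. prod_topology X Y closure_of D i = topspace (prod_topology X Y)"
     "topspace (prod_topology X Y) \<inter> (\<Inter>i. D i) \<subseteq> S"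
    using S unfolding comeagre_in_iff_dense_open by blast
  define P where "P i V = fst ` (D i \<inter> (topspace X \<times> V))" for i V
  have P: "comeagre_in X (P i V)" if "V \<in> \<B>" for i V
  proof (rule comeagre_in_dense_open)
    have o: "openin (prod_topology X Y) (D i \<inter> (topspace X \<times> V))"
      using D(1) \<B>(2)[OF that] by (intro openin_Int) (auto simp: openin_prod_Times_iff)
    show "openin X (P i V)"
      unfolding P_def using o open_map_fst open_map_def by blast
    show "X closure_of P i V = topspace X"
      unfolding dense_intersects_open
    proof clarify
      fix U assume U: "openin X U" "U \<noteq> {}" "P i V \<inter> U = {}"
      then have "openin (prod_topology X Y) (U \<times> V)" "U \<times> V \<noteq> {}"
        using \<B>(2)[OF that] by (auto simp: openin_prod_Times_iff)
      then have "D i \<inter> (U \<times> V) \<noteq> {}" using D(2) dense_intersects_open by metis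
      then show False using U(3) openin_subset[OF U(1)] unfolding P_def by force
    qed
  qed
  have "comeagre_in X (topspace X \<inter> (\<Inter>(i, V) \<in> UNIV \<times> \<B>. P i V))"
    by (rule comeagre_in_INT) (use \<B>(1) P in auto)
  moreover have "comeagre_in Y {y \<in> topspace Y. (x, y) \<in> S}"
    if x: "x \<in> topspace X" "\<And>i V. V \<in> \<B> \<Longrightarrow> x \<in> P i V" for x
    unfolding comeagre_in_iff_dense_open
  proof (intro conjI exI allI)
    show "openin Y {y \<in> topspace Y. (x, y) \<in> D i}" for i
      using D(1)[of i] x(1)
      by (intro openin_continuous_map_preimage[where Y = "prod_topology X Y"] continuous_map_pairedI) auto
    show "Y closure_of {y \<in> topspace Y. (x, y) \<in> D i} = topspace Y" for i
      unfolding dense_intersects_open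
    proof clarify
      fix U assume U: "openin Y U" "U \<noteq> {}" "{y \<in> topspace Y. (x, y) \<in> D i} \<inter> U = {}"
      then obtain V where V: "V \<in> \<B>" "V \<subseteq> U" using \<B>(3) by blast
      then have "x \<in> P i V" using x(2) by blast
      then show False using U V openin_subset[OF U(1)] unfolding P_def by fastforce
    qed
    show "topspace Y \<inter> (\<Inter>i. {y \<in> topspace Y. (x, y) \<in> D i}) \<subseteq> {y \<in> topspace Y. (x, y) \<in> S}"
      using D(3) x(1) by auto
  qed auto
  ultimately show ?thesis
    by (elim comeagre_in_superset) auto
qed

section \<open>Approximate open mappings for isometric actions\<close>

text \<open>The explicit rate, and not mere convergence, keeps limits of group products in a fixed
  closed ball and makes the convergence along branches uniform.\<close>

lemma (in Metric_space) geometric_Cauchy_limit: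
  assumes "mcomplete" "\<And>n. s n \<in> M" "\<And>n. d (s n) (s (Suc n)) \<le> c / 2 ^ Suc n"
  obtains l where "l \<in> M" "limitin mtopology s l sequentially" "\<And>n. d (s n) l \<le> c / 2 ^ n"
proof -
  \<comment> \<open>The subtracted tail makes the induction close exactly.\<close>
  have diff: "d (s n) (s (n + m)) \<le> c / 2 ^ n - c / 2 ^ (n + m)" for n m
  proof (induction m)
    case 0
    show ?case using assms(2) by simp
  next
    case (Suc m)
    have "d (s n) (s (n + Suc m)) \<le> d (s n) (s (n + m)) + d (s (n + m)) (s (Suc (n + m)))"
      using triangle[OF assms(2) assms(2) assms(2)] by simp
    also have "\<dots> \<le> (c / 2 ^ n - c / 2 ^ (n + m)) + c / 2 ^ Suc (n + m)"
      using Suc assms(3)[of "n + m"] by linarith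
    also have "\<dots> = c / 2 ^ n - c / 2 ^ (n + Suc m)" by (simp add: field_simps)
    finally show ?case .
  qed
  have c: "0 \<le> c"
    using order_trans[OF nonneg assms(3)[of 0]] by simp
  have diff': "d (s n) (s m) \<le> c / 2 ^ n" if "n \<le> m" for n m
  proof -
    have "d (s n) (s m) \<le> c / 2 ^ n - c / 2 ^ m" using diff[of n "m - n"] that by simp
    moreover have "0 \<le> c / 2 ^ m" using c by simp
    ultimately show ?thesis by linarith
  qed
  have "MCauchy s"
    unfolding MCauchy_def
  proof (intro conjI allI impI)
    show "range s \<subseteq> M" using assms(2) by blast
    fix \<epsilon> :: real assume e: "0 < \<epsilon>"
    have "(\<lambda>n. c * (1/2) ^ n) \<longlonglongrightarrow> c * 0"
      by (intro tendsto_mult_left LIMSEQ_power_zero) simp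
    then have "\<forall>\<^sub>F n in sequentially. c * (1/2) ^ n < \<epsilon>"
      using e by (intro order_tendstoD(2)[where y = "c * 0"]) auto
    then obtain N where N: "\<And>n. n \<ge> N \<Longrightarrow> c / 2 ^ n < \<epsilon>"
      unfolding eventually_sequentially by (auto simp: power_one_over field_simps)
    have "d (s n) (s n') < \<epsilon>" if "N \<le> n" "n \<le> n'" for n n'
      using diff'[OF that(2)] N[OF that(1)] by linarith
    then show "\<exists>N. \<forall>n n'. N \<le> n \<longrightarrow> N \<le> n' \<longrightarrow> d (s n) (s n') < \<epsilon>"
      by (metis commute nle_le)
  qed
  then obtain l where l: "limitin mtopology s l sequentially"
    using assms(1) unfolding mcomplete_def by blast
  then have lM: "l \<in> M" using limitin_mspace by blast
  have "d (s n) l \<le> c / 2 ^ n" for n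
  proof (rule field_le_epsilon)
    fix e :: real assume "0 < e"
    then obtain N where N: "\<And>m. m \<ge> N \<Longrightarrow> d (s m) l < e"
      using l unfolding limit_metric_sequentially by blast
    have "d (s n) l \<le> d (s n) (s (max n N)) + d (s (max n N)) l"
      using triangle assms(2) lM by blast
    then show "d (s n) l \<le> c / 2 ^ n + e"
      using diff'[of n "max n N"] N[of "max n N"] by simp
  qed
  then show ?thesis using that l lM by blast
qed

locale polish_group = group G for G (structure) +
  fixes T :: "'a topology"
  assumes polish: "Polish_group G T"
begin

lemma topspace_T [simp]: "topspace T = carrier G"
  using polish by (simp add: Polish_group_def)

lemma completely_metrizable_T: "completely_metrizable_space T"
  and separable_T: "separable_space T"
  using polish by (simp_all add: Polish_group_def Polish_space_def)

lemma has_countable_pi_base_T: "has_countable_pi_base T"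
  using completely_metrizable_T separable_T
  by (simp add: completely_metrizable_imp_metrizable_space has_countable_pi_base_metrizable)

lemma continuous_mult:
  assumes "continuous_map X T f" "continuous_map X T g"
  shows "continuous_map X T (\<lambda>x. f x \<otimes> g x)"
proof -
  have "continuous_map X T ((\<lambda>(x, y). x \<otimes> y) \<circ> (\<lambda>x. (f x, g x)))"
    using polish assms unfolding Polish_group_def
    by (intro continuous_map_compose[where X' = "prod_topology T T"] continuous_map_pairedI) auto
  then show ?thesis by (simp add: o_def)
qed

lemma continuous_inv:
  assumes "continuous_map X T f"
  shows "continuous_map X T (\<lambda>x. inv (f x))"
proof -
  have "continuous_map X T ((\<lambda>x. inv x) \<circ> f)"
    using polish assms unfolding Polish_group_def by (intro continuous_map_compose) auto
  then show ?thesis by (simp add: o_def)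
qed

lemma obtain_metric:
  obtains \<rho> where "Metric_space (carrier G) \<rho>" "Metric_space.mcomplete (carrier G) \<rho>"
    "Metric_space.mtopology (carrier G) \<rho> = T"
  using completely_metrizable_T unfolding completely_metrizable_space_def
  by (metis Metric_space.topspace_mtopology topspace_T)

text \<open>The two forms serve different ends: \<open>b \<otimes> inv a\<close> carries one point
  near an orbit to another, and \<open>inv b \<otimes> a\<close> combines the two limits of the
  back-and-forth argument.\<close>

lemma division_neighbourhood:
  assumes "openin T W" "\<one> \<in> W"
  obtains V where "openin T V" "\<one> \<in> V" "\<And>a b. a \<in> V \<Longrightarrow> b \<in> V \<Longrightarrow> inv b \<otimes> a \<in> W"
    "\<And>a b. a \<in> V \<Longrightarrow> b \<in> V \<Longrightarrow> b \<otimes> inv a \<in> W"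
proof -
  let ?P = "{p \<in> topspace (prod_topology T T). inv (snd p) \<otimes> fst p \<in> W} \<inter>
            {p \<in> topspace (prod_topology T T). snd p \<otimes> inv (fst p) \<in> W}"
  have "openin (prod_topology T T) ?P"
    by (intro openin_Int openin_continuous_map_preimage[OF _ assms(1)] continuous_mult continuous_inv
        continuous_map_fst continuous_map_snd)
  moreover have "(\<one>, \<one>) \<in> ?P" using assms(2) by simp
  ultimately have "\<exists>A B. openin T A \<and> openin T B \<and> \<one> \<in> A \<and> \<one> \<in> B \<and> A \<times> B \<subseteq> ?P"
    unfolding openin_prod_topology_alt by (elim allE impE)
  then obtain A B where "openin T A" "openin T B" "\<one> \<in> A" "\<one> \<in> B" "A \<times> B \<subseteq> ?P"
    by (elim exE conjE)
  then have "openin T (A \<inter> B)" "\<one> \<in> A \<inter> B"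
    "\<And>a b. a \<in> A \<inter> B \<Longrightarrow> b \<in> A \<inter> B \<Longrightarrow> (a, b) \<in> ?P" by blast+
  then show ?thesis by (intro that[of "A \<inter> B"]) auto
qed

end

text \<open>Estimates are made with \<open>D\<close>, while convergence takes place in
  \<open>Z\<close>. The two are linked by \<open>D_closed\<close>, which is lower semicontinuity,
  and by \<open>act_continuous\<close>, at the moment where a limit is taken.\<close>

locale isometric_action = polish_group +
  fixes Z :: "'c topology" and D :: "'c \<Rightarrow> 'c \<Rightarrow> real" and act :: "'a \<Rightarrow> 'c \<Rightarrow> 'c"
  assumes completely_metrizable_Z: "completely_metrizable_space Z"
    and act_closed: "g \<in> carrier G \<Longrightarrow> z \<in> topspace Z \<Longrightarrow> act g z \<in> topspace Z"
    and act_one: "z \<in> topspace Z \<Longrightarrow> act \<one> z = z"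
    and act_mult: "g \<in> carrier G \<Longrightarrow> h \<in> carrier G \<Longrightarrow> z \<in> topspace Z \<Longrightarrow>
                     act (g \<otimes> h) z = act g (act h z)"
    and act_continuous: "z \<in> topspace Z \<Longrightarrow> continuous_map T Z (\<lambda>g. act g z)"
    and D_self: "z \<in> topspace Z \<Longrightarrow> D z z = 0"
    and D_commute: "x \<in> topspace Z \<Longrightarrow> y \<in> topspace Z \<Longrightarrow> D x y = D y x"
    and D_triangle: "x \<in> topspace Z \<Longrightarrow> y \<in> topspace Z \<Longrightarrow> z \<in> topspace Z \<Longrightarrow>
                       D x z \<le> D x y + D y z"
    and D_act: "g \<in> carrier G \<Longrightarrow> x \<in> topspace Z \<Longrightarrow> y \<in> topspace Z \<Longrightarrow>
                       D (act g x) (act g y) = D x y"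
    and D_closed: "closedin (prod_topology Z Z) {(x, y) \<in> topspace Z \<times> topspace Z. D x y \<le> r}"
begin

definition thick_orbit :: "'a set \<Rightarrow> real \<Rightarrow> 'c \<Rightarrow> 'c set" where
  "thick_orbit W \<delta> z = {z' \<in> topspace Z. \<exists>w\<in>W. D (act w z) z' < \<delta>}"

text \<open>A substitute for the points of a comeagre orbit. For such an orbit Effros' theorem makes
  each \<open>W z\<close> comeagre in a neighbourhood of \<open>z\<close>; here the piece of orbit
  is thickened and comeagre is weakened to nonmeagre everywhere nearby.\<close>

definition locally_nonmeagre_orbits :: "'c set" where
  "locally_nonmeagre_orbits = {z \<in> topspace Z. \<forall>W \<delta>. openin T W \<and> \<one> \<in> W \<and> 0 < \<delta> \<longrightarrow>
     (\<exists>U. openin Z U \<and> z \<in> U \<and>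
        (\<forall>V. openin Z V \<and> V \<noteq> {} \<and> V \<subseteq> U \<longrightarrow> \<not> meagre_in Z (thick_orbit W \<delta> z \<inter> V)))}"

text \<open>Countably many translates of a small neighbourhood of the identity cover the group, so a thick
  dense orbit splits into countably many pieces, and almost every point lies in the nonmeagre locus
  of a piece containing it.\<close>

lemma comeagre_locally_nonmeagre_orbits:
  assumes base: "has_countable_pi_base Z"
    and gen: "\<And>\<epsilon>. 0 < \<epsilon> \<Longrightarrow> \<exists>g\<in>topspace Z. comeagre_in Z {z \<in> topspace Z. \<exists>k\<in>carrier G. D z (act k g) < \<epsilon>}"
  shows "comeagre_in Z locally_nonmeagre_orbits"
proof -
  let ?loc = "\<lambda>W \<delta> z. \<exists>U. openin Z U \<and> z \<in> U \<and>
        (\<forall>V. openin Z V \<and> V \<noteq> {} \<and> V \<subseteq> U \<longrightarrow> \<not> meagre_in Z (thick_orbit W \<delta> z \<inter> V))"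
  have one: "comeagre_in Z {z \<in> topspace Z. ?loc W \<delta> z}"
    if W: "openin T W" "\<one> \<in> W" and \<delta>: "0 < \<delta>" for W \<delta>
  proof -
    obtain N where N: "openin T N" "\<one> \<in> N" "\<And>a b. a \<in> N \<Longrightarrow> b \<in> N \<Longrightarrow> b \<otimes> inv a \<in> W"
      using division_neighbourhood[OF W] by metis
    have NG: "N \<subseteq> carrier G" and WG: "W \<subseteq> carrier G"
      using openin_subset[OF N(1)] openin_subset[OF W(1)] by simp_all
    obtain C where C: "countable C" "C \<subseteq> carrier G" "T closure_of C = topspace T"
      using separable_T unfolding separable_space_def by auto
    obtain g where g: "g \<in> topspace Z"
      "comeagre_in Z {z \<in> topspace Z. \<exists>k\<in>carrier G. D z (act k g) < \<delta> / 2}"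
      using gen[of "\<delta> / 2"] \<delta> by auto
    \<comment> \<open>These are the points near the piece \<open>N c g\<close> of the orbit. Two
      points of one piece are related by some \<open>b \<otimes> inv a\<close> in \<open>W\<close>,
      with one error of \<open>\<delta> / 2\<close> for each of them.\<close>
    define B where "B c = {z \<in> topspace Z. \<exists>w\<in>N. D z (act (w \<otimes> c) g) < \<delta> / 2}" for c
    have "\<exists>U. openin Z U \<and> meagre_in Z (B c - U) \<and>
       (\<forall>V. openin Z V \<longrightarrow> V \<noteq> {} \<longrightarrow> V \<subseteq> U \<longrightarrow> \<not> meagre_in Z (B c \<inter> V))" for c
      by (rule nonmeagre_locus[OF base, of "B c"]) (auto simp: B_def)
    then obtain U where U: "\<And>c. openin Z (U c)" "\<And>c. meagre_in Z (B c - U c)"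
       "\<And>c V. openin Z V \<Longrightarrow> V \<noteq> {} \<Longrightarrow> V \<subseteq> U c \<Longrightarrow> \<not> meagre_in Z (B c \<inter> V)"
      by metis
    have cover: "\<exists>c\<in>C. \<exists>w\<in>N. k = w \<otimes> c" if k: "k \<in> carrier G" for k
    proof -
      have "openin T {c \<in> topspace T. k \<otimes> inv c \<in> N}"
        using k by (intro openin_continuous_map_preimage[OF _ N(1)] continuous_mult continuous_inv) auto
      moreover have "k \<in> {c \<in> topspace T. k \<otimes> inv c \<in> N}" using k N(2) by simp
      ultimately obtain c where "c \<in> C" "k \<otimes> inv c \<in> N"
        using C(3) dense_intersects_open[of T C] by blast
      moreover have "k = (k \<otimes> inv c) \<otimes> c"
        using k \<open>c \<in> C\<close> C(2) by (simp add: m_assoc subsetD)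
      ultimately show ?thesis by blast
    qed
    have thick: "B c \<subseteq> thick_orbit W \<delta> z" if z: "z \<in> B c" and c: "c \<in> C" for z c
    proof
      fix y assume "y \<in> B c"
      then obtain b where b: "b \<in> N" "D y (act (b \<otimes> c) g) < \<delta> / 2" "y \<in> topspace Z"
        unfolding B_def by blast
      obtain a where a: "a \<in> N" "D z (act (a \<otimes> c) g) < \<delta> / 2" "z \<in> topspace Z"
        using z unfolding B_def by blast
      have mem: "a \<in> carrier G" "b \<in> carrier G" "c \<in> carrier G"
        using a b c NG C(2) by auto
      have eq: "act (b \<otimes> inv a) (act (a \<otimes> c) g) = act (b \<otimes> c) g"
      proof -
        have "(b \<otimes> inv a) \<otimes> (a \<otimes> c) = b \<otimes> c"
          using mem by (metis inv_closed l_inv m_assoc m_closed r_one)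
        then show ?thesis using mem g(1) act_mult[of "b \<otimes> inv a" "a \<otimes> c" g] by simp
      qed
      have "D (act (b \<otimes> inv a) z) y
          \<le> D (act (b \<otimes> inv a) z) (act (b \<otimes> c) g) + D (act (b \<otimes> c) g) y"
        using mem a b g by (intro D_triangle) (auto simp: act_closed)
      also have "D (act (b \<otimes> inv a) z) (act (b \<otimes> c) g) = D z (act (a \<otimes> c) g)"
        unfolding eq[symmetric] using mem a g by (intro D_act) (auto simp: act_closed)
      also have "D (act (b \<otimes> c) g) y = D y (act (b \<otimes> c) g)"
        using mem b g by (intro D_commute) (auto simp: act_closed)
      finally have "D (act (b \<otimes> inv a) z) y < \<delta>" using a b by linarith
      then show "y \<in> thick_orbit W \<delta> z"
        unfolding thick_orbit_def using b N(3)[OF a(1) b(1)] by blast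
    qed
    have "{z \<in> topspace Z. \<exists>k\<in>carrier G. D z (act k g) < \<delta> / 2} \<inter> (topspace Z \<inter> (\<Inter>c\<in>C. topspace Z - (B c - U c)))
      \<subseteq> {z \<in> topspace Z. ?loc W \<delta> z}"
    proof
      fix z assume z: "z \<in> {z \<in> topspace Z. \<exists>k\<in>carrier G. D z (act k g) < \<delta> / 2} \<inter>
             (topspace Z \<inter> (\<Inter>c\<in>C. topspace Z - (B c - U c)))"
      then obtain k where k: "k \<in> carrier G" "D z (act k g) < \<delta> / 2" "z \<in> topspace Z" by blast
      obtain c w where c: "c \<in> C" "w \<in> N" "k = w \<otimes> c" using cover[OF k(1)] by blast
      then have zB: "z \<in> B c" using k unfolding B_def by blast
      then have zU: "z \<in> U c" using z c by blast
      have "\<not> meagre_in Z (thick_orbit W \<delta> z \<inter> V)"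
        if V: "openin Z V" "V \<noteq> {}" "V \<subseteq> U c" for V
        using U(3)[OF V] thick[OF zB c(1)] meagre_in_subset[of Z "thick_orbit W \<delta> z \<inter> V" "B c \<inter> V"] by blast
      then show "z \<in> {z \<in> topspace Z. ?loc W \<delta> z}" using U(1) zU k(3) by blast
    qed
    moreover have "comeagre_in Z (topspace Z \<inter> (\<Inter>c\<in>C. topspace Z - (B c - U c)))"
    proof (rule comeagre_in_INT[OF C(1)])
      fix c
      show "comeagre_in Z (topspace Z - (B c - U c))"
        unfolding comeagre_in_def
        by (intro conjI meagre_in_subset[OF U(2)[of c]]) auto
    qed
    ultimately show ?thesis
      using comeagre_in_superset[OF comeagre_in_Int[OF g(2)]] by blast
  qed
  obtain \<rho> where \<rho>: "Metric_space (carrier G) \<rho>" "Metric_space.mtopology (carrier G) \<rho> = T"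
    using obtain_metric by metis
  interpret R: Metric_space "carrier G" \<rho> by fact
  \<comment> \<open>Countably many pairs of a neighbourhood and a thickness suffice, since
    \<open>thick_orbit\<close> is monotone in both.\<close>
  define W where "W i = R.mball \<one> (1 / real (Suc i))" for i
  have W: "openin T (W i)" "\<one> \<in> W i" for i
    using R.openin_mball[of \<one> "1 / real (Suc i)"] \<rho>(2) by (simp_all add: W_def)
  have "comeagre_in Z (topspace Z \<inter> (\<Inter>i::nat. {z \<in> topspace Z. ?loc (W i) (1 / real (Suc i)) z}))"
    by (rule comeagre_in_INT) (auto intro!: one W)
  moreover have "topspace Z \<inter> (\<Inter>i. {z \<in> topspace Z. ?loc (W i) (1 / real (Suc i)) z}) \<subseteq> locally_nonmeagre_orbits"
  proof
    fix z assume z: "z \<in> topspace Z \<inter> (\<Inter>i. {z \<in> topspace Z. ?loc (W i) (1 / real (Suc i)) z})"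
    have "?loc W' \<delta> z" if W': "openin T W'" "\<one> \<in> W'" "0 < \<delta>" for W' \<delta>
    proof -
      obtain r where r: "r > 0" "R.mball \<one> r \<subseteq> W'"
        using W'(1,2) unfolding \<rho>(2)[symmetric] R.openin_mtopology by blast
      obtain i :: nat where i: "1 / real (Suc i) < min r \<delta>"
        using nat_approx_posE[of "min r \<delta>"] r(1) W'(3) by (auto simp del: of_nat_Suc)
      then have "W i \<subseteq> W'" using r(2) unfolding W_def by (auto simp del: of_nat_Suc)
      then have sub: "thick_orbit (W i) (1 / real (Suc i)) z \<subseteq> thick_orbit W' \<delta> z"
        using i unfolding thick_orbit_def by force
      obtain U where U: "openin Z U" "z \<in> U"
        "\<And>V. openin Z V \<Longrightarrow> V \<noteq> {} \<Longrightarrow> V \<subseteq> U \<Longrightarrow> \<not> meagre_in Z (thick_orbit (W i) (1 / real (Suc i)) z \<inter> V)"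
      proof -
        have "?loc (W i) (1 / real (Suc i)) z" using z by (simp only: Int_iff INT_iff mem_Collect_eq UNIV_I simp_thms)
        then show thesis using that by metis
      qed
      then have "\<not> meagre_in Z (thick_orbit W' \<delta> z \<inter> V)" if "openin Z V" "V \<noteq> {}" "V \<subseteq> U" for V
        using that sub by (meson Int_mono meagre_in_subset order_refl)
      then show ?thesis using U(1,2) by blast
    qed
    then show "z \<in> locally_nonmeagre_orbits"
      unfolding locally_nonmeagre_orbits_def mem_Collect_eq using z by (intro conjI allI impI) simp_all
  qed
  ultimately show ?thesis
    by (elim comeagre_in_superset) (auto simp: locally_nonmeagre_orbits_def)
qed

text \<open>An approximate version of Effros' theorem, with a back-and-forth argument in place of the Baire
  property of analytic sets: the two points are moved alternately, each time to a generic point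
  close to the current position of the other one, along a sequence \<open>u\<close> with \<open>u 0 = z\<close>, \<open>u 1 = z'\<close>
  and \<open>u (k + 2)\<close> approximately in the orbit of \<open>u k\<close>. Lower semicontinuity passes the estimates
  to the common limit.\<close>

lemma approximate_transitivity:
  assumes \<Gamma>: "comeagre_in Z \<Gamma>" "\<Gamma> \<subseteq> locally_nonmeagre_orbits"
    and z: "z \<in> \<Gamma>" and W: "openin T W" "\<one> \<in> W" and \<delta>: "0 < \<delta>"
  obtains U where "openin Z U" "z \<in> U" "\<And>z'. z' \<in> \<Gamma> \<Longrightarrow> z' \<in> U \<Longrightarrow> \<exists>f\<in>W. D (act f z) z' < \<delta>"
proof -
  have \<Gamma>Z: "\<Gamma> \<subseteq> topspace Z" using \<Gamma>(1) by (simp add: comeagre_in_def)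
  obtain \<rho> where \<rho>: "Metric_space (carrier G) \<rho>" "Metric_space.mcomplete (carrier G) \<rho>"
    "Metric_space.mtopology (carrier G) \<rho> = T"
    using obtain_metric by metis
  interpret R: Metric_space "carrier G" \<rho> by fact
  obtain \<sigma> where \<sigma>: "Metric_space (topspace Z) \<sigma>" "Metric_space.mcomplete (topspace Z) \<sigma>"
    "Metric_space.mtopology (topspace Z) \<sigma> = Z"
    using completely_metrizable_Z unfolding completely_metrizable_space_def
    by (metis Metric_space.topspace_mtopology)
  interpret S: Metric_space "topspace Z" \<sigma> by fact
  \<comment> \<open>The element finally produced is \<open>inv b \<otimes> a\<close>, where
    \<open>a\<close> and \<open>b\<close> are the limits of the products that move \<open>z\<close>
    and \<open>z'\<close> respectively.\<close>
  obtain N0 where N0: "openin T N0" "\<one> \<in> N0" "\<And>a b. a \<in> N0 \<Longrightarrow> b \<in> N0 \<Longrightarrow> inv b \<otimes> a \<in> W"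
    using division_neighbourhood[OF W] by metis
  obtain r0 where "r0 > 0" "R.mball \<one> r0 \<subseteq> N0"
    using N0(1,2) unfolding \<rho>(3)[symmetric] R.openin_mtopology by blast
  \<comment> \<open>A closed ball, because the limits inherit only a non-strict bound.\<close>
  then obtain r where r: "r > 0" "R.mcball \<one> r \<subseteq> N0"
    by (meson R.mcball_subset_mball_concentric dense order_trans half_gt_zero field_sum_of_halves field_less_half_sum)
  have "\<exists>U. openin Z U \<and> x \<in> U \<and>
      (\<forall>V. openin Z V \<longrightarrow> V \<noteq> {} \<longrightarrow> V \<subseteq> U \<longrightarrow> (\<exists>y\<in>\<Gamma> \<inter> V. \<exists>w\<in>W'. D (act w x) y < \<epsilon>))"
    if x: "x \<in> \<Gamma>" "openin T W'" "\<one> \<in> W'" "0 < \<epsilon>" for x W' \<epsilon>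
  proof -
    have "x \<in> locally_nonmeagre_orbits" using x(1) \<Gamma>(2) by blast
    then obtain U where U: "openin Z U" "x \<in> U"
      "\<And>V. openin Z V \<Longrightarrow> V \<noteq> {} \<Longrightarrow> V \<subseteq> U \<Longrightarrow> \<not> meagre_in Z (thick_orbit W' \<epsilon> x \<inter> V)"
      using x(2-4) unfolding locally_nonmeagre_orbits_def mem_Collect_eq by metis
    have "\<exists>y\<in>\<Gamma> \<inter> V. \<exists>w\<in>W'. D (act w x) y < \<epsilon>" if V: "openin Z V" "V \<noteq> {}" "V \<subseteq> U" for V
    proof -
      have "\<not> meagre_in Z ((thick_orbit W' \<epsilon> x \<inter> V) \<inter> \<Gamma>)"
        using U(3)[OF V] by (intro comeagre_Int_nonmeagre[OF \<Gamma>(1)]) (auto simp: thick_orbit_def)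
      then have "(thick_orbit W' \<epsilon> x \<inter> V) \<inter> \<Gamma> \<noteq> {}" using meagre_in_empty by metis
      then show ?thesis unfolding thick_orbit_def by blast
    qed
    then show ?thesis using U(1,2) by blast
  qed
  then obtain N where N: "\<And>x W' \<epsilon>. x \<in> \<Gamma> \<Longrightarrow> openin T W' \<Longrightarrow> \<one> \<in> W' \<Longrightarrow> 0 < \<epsilon> \<Longrightarrow>
      openin Z (N x W' \<epsilon>) \<and> x \<in> N x W' \<epsilon> \<and>
      (\<forall>V. openin Z V \<longrightarrow> V \<noteq> {} \<longrightarrow> V \<subseteq> N x W' \<epsilon> \<longrightarrow> (\<exists>y\<in>\<Gamma> \<inter> V. \<exists>w\<in>W'. D (act w x) y < \<epsilon>))"
    by metis
  \<comment> \<open>The metric \<open>\<rho>\<close> is complete but in general not invariant, so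
    the next factor \<open>w\<close> is required to move the current product \<open>f\<close> little
    instead of being close to \<open>\<one>\<close>.\<close>
  define W' where "W' k f = {w \<in> topspace T. w \<otimes> f \<in> R.mball f (r / 2 ^ Suc k)}" for k :: nat and f
  have W': "openin T (W' k f)" "\<one> \<in> W' k f" if "f \<in> carrier G" for k f
  proof -
    have "openin T (R.mball f (r / 2 ^ Suc k))" using R.openin_mball \<rho>(3) by metis
    moreover have "continuous_map T T (\<lambda>w. w \<otimes> f)"
      using that by (intro continuous_mult) auto
    ultimately show "openin T (W' k f)"
      unfolding W'_def by (rule openin_continuous_map_preimage[rotated])
    show "\<one> \<in> W' k f" using that r(1) by (simp add: W'_def)
  qed
  \<comment> \<open>These errors sum to \<open>\<delta> / 4\<close>. Each of the two moving points
    thus ends within \<open>\<delta> / 4\<close> of the common limit, and twice that is less than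
    \<open>\<delta>\<close>.\<close>
  define \<epsilon> where "\<epsilon> k = \<delta> / 2 ^ (k + 3)" for k :: nat
  have \<epsilon>: "\<epsilon> k > 0" for k using \<delta> by (simp add: \<epsilon>_def)
  define N' where "N' k u f = N u (W' k f) (\<epsilon> k)" for k u f
  have N'_open: "openin Z (N' k u f)" and N'_mem: "u \<in> N' k u f"
    and N'_meets: "\<And>V. openin Z V \<Longrightarrow> V \<noteq> {} \<Longrightarrow> V \<subseteq> N' k u f \<Longrightarrow> \<exists>y\<in>\<Gamma> \<inter> V. \<exists>w\<in>W' k f. D (act w u) y < \<epsilon> k"
    if "u \<in> \<Gamma>" "f \<in> carrier G" for u f k
    using N[OF that(1) W'[OF that(2)] \<epsilon>] unfolding N'_def by blast+
  have approx: "\<exists>f\<in>W. D (act f z) z' < \<delta>" if z': "z' \<in> \<Gamma>" "z' \<in> N' 0 z \<one>" for z'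
  proof -
    \<comment> \<open>A state holds two successive points together with the group products belonging
      to them. The condition \<open>u' \<in> N' k u f\<close> says that points arbitrarily close to
      \<open>u'\<close> can be reached approximately from \<open>u\<close> by a small factor, so
      \<open>u\<close> is moved next and the two points exchange roles.\<close>
    define P where "P = (\<lambda>(k :: nat) (u, f, u', f').
       u \<in> \<Gamma> \<and> u' \<in> \<Gamma> \<and> f \<in> carrier G \<and> f' \<in> carrier G \<and> u' \<in> N' k u f
       \<and> (k = 0 \<longrightarrow> u = z \<and> f = \<one> \<and> u' = z' \<and> f' = \<one>))"
    define Q where "Q = (\<lambda>(k :: nat) (u, f, u', f' :: 'a) (v, h, v', h').
       v = u' \<and> h = f' \<and> \<sigma> u' v' < 1 / 2 ^ Suc k \<and> \<rho> f h' < r / 2 ^ Suc k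
       \<and> (\<exists>w\<in>carrier G. h' = w \<otimes> f \<and> D (act w u) v' < \<epsilon> k))"
    have "\<exists>s. \<forall>k. P k (s k) \<and> Q k (s k) (s (Suc k))"
    proof (rule dependent_nat_choice)
      show "\<exists>x. P 0 x"
        by (intro exI[of _ "(z, \<one>, z', \<one>)"]) (use z z' in \<open>simp add: P_def\<close>)
      fix x k assume "P k x"
      then obtain u f u' f' where x: "x = (u, f, u', f')" "u \<in> \<Gamma>" "u' \<in> \<Gamma>"
        "f \<in> carrier G" "f' \<in> carrier G" "u' \<in> N' k u f"
        unfolding P_def by (cases x) auto
      \<comment> \<open>The first set makes the new point reachable from \<open>u\<close>, the
        second restores the invariant with the roles exchanged, and the ball makes the sequence of
        points Cauchy.\<close>
      define V where "V = N' k u f \<inter> N' (Suc k) u' f' \<inter> S.mball u' (1 / 2 ^ Suc k)"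
      have "openin Z (S.mball u' (1 / 2 ^ Suc k))" using S.openin_mball \<sigma>(3) by metis
      then have "openin Z V" unfolding V_def using x by (intro openin_Int N'_open)
      moreover have "u' \<in> V" unfolding V_def using x N'_mem \<Gamma>Z by auto
      moreover have "V \<subseteq> N' k u f" unfolding V_def by blast
      ultimately obtain v' w where v': "v' \<in> \<Gamma>" "v' \<in> V" "w \<in> W' k f" "D (act w u) v' < \<epsilon> k"
        using N'_meets[OF x(2,4), of V k] by blast
      have "P (Suc k) (u', f', v', w \<otimes> f)"
        unfolding P_def using v' x unfolding V_def W'_def by auto
      moreover have "Q k x (u', f', v', w \<otimes> f)"
        unfolding Q_def x(1) using v' x unfolding V_def W'_def by auto
      ultimately show "\<exists>y. P (Suc k) y \<and> Q k x y" by blast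
    qed
    then obtain s where s: "\<And>k. P k (s k)" "\<And>k. Q k (s k) (s (Suc k))" by blast
    define u where "u k = fst (s k)" for k
    define f where "f k = fst (snd (s k))" for k
    have next_eq: "fst (snd (snd (s k))) = u (Suc k)" "snd (snd (snd (s k))) = f (Suc k)" for k
      using s(2)[of k] unfolding Q_def u_def f_def by (auto split: prod.splits)
    have s_eq: "s k = (u k, f k, u (Suc k), f (Suc k))" for k
      using next_eq[of k] by (simp add: u_def f_def prod_eq_iff)
    have mem: "u k \<in> \<Gamma>" "f k \<in> carrier G" for k
      using s(1)[of k] unfolding s_eq by (simp_all add: P_def)
    have start: "u 0 = z" "f 0 = \<one>" "u 1 = z'" "f 1 = \<one>"
      using s(1)[of 0] unfolding s_eq by (simp_all add: P_def)
    have close: "\<sigma> (u (Suc k)) (u (Suc (Suc k))) < 1 / 2 ^ Suc k"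
         "\<rho> (f k) (f (Suc (Suc k))) < r / 2 ^ Suc k"
         "\<exists>w\<in>carrier G. f (Suc (Suc k)) = w \<otimes> f k \<and> D (act w (u k)) (u (Suc (Suc k))) < \<epsilon> k" for k
      using s(2)[of k] unfolding s_eq by (simp_all add: Q_def)
    have uZ: "u k \<in> topspace Z" for k using mem \<Gamma>Z by blast
    obtain p where p: "p \<in> topspace Z" "limitin Z (\<lambda>k. u (Suc k)) p sequentially"
    proof (rule S.geometric_Cauchy_limit[OF \<sigma>(2), of "\<lambda>k. u (Suc k)" 1])
      show "u (Suc k) \<in> topspace Z" for k by (rule uZ)
      show "\<sigma> (u (Suc k)) (u (Suc (Suc k))) \<le> 1 / 2 ^ Suc k" for k
        using close(1)[of k] by linarith
    qed (unfold \<sigma>(3), rule that)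
    have p': "limitin Z u p sequentially"
      using p(2) by (rule limitin_sequentially_offset_rev[of Z u 1, simplified])
    \<comment> \<open>Even and odd positions form two chains with separate products, both starting
      from \<open>\<one>\<close>; \<open>b\<close> will be 0 or 1. The chains share the limit point
      \<open>p\<close>, but each has its own limit \<open>l\<close> in the group.\<close>
    have parity: "\<exists>l\<in>R.mcball \<one> r. D (act l (u b)) p \<le> \<delta> / 4" if fb: "f b = \<one>" for b
    proof -
      have step: "\<rho> (f (b + 2 * j)) (f (b + 2 * Suc j)) \<le> r / 2 ^ Suc j" for j
      proof -
        have "\<rho> (f (b + 2 * j)) (f (b + 2 * Suc j)) \<le> r / 2 ^ Suc (b + 2 * j)"
          using close(2)[of "b + 2 * j"] by simp
        also have "\<dots> \<le> r / 2 ^ Suc j"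
          using r(1) by (intro divide_left_mono power_increasing) auto
        finally show ?thesis .
      qed
      obtain l where l: "l \<in> carrier G" "limitin T (\<lambda>j. f (b + 2 * j)) l sequentially" "\<rho> (f b) l \<le> r"
      proof (rule R.geometric_Cauchy_limit[OF \<rho>(2), of "\<lambda>j. f (b + 2 * j)" r])
        show "f (b + 2 * j) \<in> carrier G" for j by (rule mem(2))
        show "\<rho> (f (b + 2 * j)) (f (b + 2 * Suc j)) \<le> r / 2 ^ Suc j" for j by (rule step)
        fix l assume l: "l \<in> carrier G" "limitin R.mtopology (\<lambda>j. f (b + 2 * j)) l sequentially"
          "\<And>j. \<rho> (f (b + 2 * j)) l \<le> r / 2 ^ j"
        show thesis using that[OF l(1)] l(2) l(3)[of 0] unfolding \<rho>(3) by simp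
      qed
      have bound: "D (act (f (b + 2 * j)) (u b)) (u (b + 2 * j)) \<le> \<delta> / 4 - \<delta> / 4 / 2 ^ j" for j
      proof (induction j)
        case 0
        then show ?case using fb uZ by (simp add: act_one D_self)
      next
        case (Suc j)
        obtain w where w: "w \<in> carrier G" "f (b + 2 * Suc j) = w \<otimes> f (b + 2 * j)"
          "D (act w (u (b + 2 * j))) (u (b + 2 * Suc j)) < \<epsilon> (b + 2 * j)"
          using close(3)[of "b + 2 * j"] by auto
        have "D (act (f (b + 2 * Suc j)) (u b)) (u (b + 2 * Suc j))
           \<le> D (act (f (b + 2 * Suc j)) (u b)) (act w (u (b + 2 * j))) + D (act w (u (b + 2 * j))) (u (b + 2 * Suc j))"
          using uZ mem w(1) by (intro D_triangle act_closed) auto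
        also have "D (act (f (b + 2 * Suc j)) (u b)) (act w (u (b + 2 * j)))
             = D (act (f (b + 2 * j)) (u b)) (u (b + 2 * j))"
          using uZ mem w(1) by (simp only: w(2) act_mult D_act act_closed)
        also have "\<dots> \<le> \<delta> / 4 - \<delta> / 4 / 2 ^ j" by (rule Suc)
        also have "D (act w (u (b + 2 * j))) (u (b + 2 * Suc j)) \<le> \<delta> / 2 ^ (j + 3)"
        proof -
          have "\<epsilon> (b + 2 * j) \<le> \<delta> / 2 ^ (j + 3)"
            unfolding \<epsilon>_def using \<delta> by (intro divide_left_mono power_increasing) auto
          then show ?thesis using w(3) by linarith
        qed
        also have "\<delta> / 4 - \<delta> / 4 / 2 ^ j + \<delta> / 2 ^ (j + 3) = \<delta> / 4 - \<delta> / 4 / 2 ^ Suc j"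
          by (simp add: field_simps power_add)
        finally show ?case by simp
      qed
      have lim1: "limitin Z (\<lambda>j. act (f (b + 2 * j)) (u b)) (act l (u b)) sequentially"
        using continuous_map_limit[OF act_continuous[OF uZ] l(2)] by (simp add: o_def)
      have "strict_mono (\<lambda>j. b + 2 * j)" by (simp add: strict_mono_def)
      then have lim2: "limitin Z (\<lambda>j. u (b + 2 * j)) p sequentially"
        using limitin_subsequence[OF _ p'] by (simp add: o_def)
      have "(act l (u b), p) \<in> {(x, y) \<in> topspace Z \<times> topspace Z. D x y \<le> \<delta> / 4}"
      proof (rule limitin_closedin[where F = sequentially])
        show "limitin (prod_topology Z Z) (\<lambda>j. (act (f (b + 2 * j)) (u b), u (b + 2 * j))) (act l (u b), p) sequentially"
          using lim1 lim2 by (simp add: limitin_pairwise o_def)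
        show "\<forall>\<^sub>F j in sequentially. (act (f (b + 2 * j)) (u b), u (b + 2 * j))
                 \<in> {(x, y) \<in> topspace Z \<times> topspace Z. D x y \<le> \<delta> / 4}"
        proof (rule always_eventually, rule allI)
          fix j
          have "\<delta> / 4 / 2 ^ j \<ge> 0" using \<delta> by simp
          then show "(act (f (b + 2 * j)) (u b), u (b + 2 * j))
                 \<in> {(x, y) \<in> topspace Z \<times> topspace Z. D x y \<le> \<delta> / 4}"
            using bound[of j] uZ mem by (simp add: act_closed)
        qed
      qed (rule D_closed, simp)
      then show ?thesis using l fb by auto
    qed
    obtain a where a: "a \<in> R.mcball \<one> r" "D (act a z) p \<le> \<delta> / 4"
      using parity[OF start(2)] start(1) by metis
    obtain b where b: "b \<in> R.mcball \<one> r" "D (act b z') p \<le> \<delta> / 4"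
      using parity[OF start(4)] start(3) by metis
    have ab: "a \<in> carrier G" "b \<in> carrier G" using a b by auto
    have zz: "z \<in> topspace Z" "z' \<in> topspace Z" using z z' \<Gamma>Z by auto
    have "D (act (inv b \<otimes> a) z) z' = D (act b (act (inv b \<otimes> a) z)) (act b z')"
      using ab zz by (simp add: D_act act_closed)
    also have "act b (act (inv b \<otimes> a) z) = act a z"
      using ab zz by (simp add: act_mult[symmetric] m_assoc[symmetric])
    also have "D (act a z) (act b z') \<le> D (act a z) p + D p (act b z')"
      using ab zz p by (intro D_triangle act_closed)
    also have "D p (act b z') = D (act b z') p"
      using ab zz p by (intro D_commute act_closed)
    finally have "D (act (inv b \<otimes> a) z) z' < \<delta>" using a(2) b(2) \<delta> by linarith
    moreover have "inv b \<otimes> a \<in> W" using N0(3) a b r(2) by blast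
    ultimately show ?thesis by blast
  qed
  show ?thesis
    using that[OF N'_open[OF z one_closed, of 0] N'_mem[OF z one_closed] approx] by blast
qed

end

section \<open>Tuples in a topometric group\<close>

locale topometric_group = polish_group +
  fixes d :: "'a \<Rightarrow> 'a \<Rightarrow> real"
  assumes topometric: "Polish_topometric_group G T d"
begin

sublocale d: Metric_space "carrier G" d
  using topometric by (simp add: Polish_topometric_group_def)

lemma d_invariant:
  "g \<in> carrier G \<Longrightarrow> h \<in> carrier G \<Longrightarrow> x \<in> carrier G \<Longrightarrow> y \<in> carrier G \<Longrightarrow>
     d (g \<otimes> x \<otimes> h) (g \<otimes> y \<otimes> h) = d x y"
  using topometric by (simp add: Polish_topometric_group_def)

lemma d_left_invariant:
  "g \<in> carrier G \<Longrightarrow> x \<in> carrier G \<Longrightarrow> y \<in> carrier G \<Longrightarrow> d (g \<otimes> x) (g \<otimes> y) = d x y"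
  using d_invariant[of g \<one> x y] by simp

lemma closedin_d_le: "closedin (prod_topology T T) {(x, y) \<in> carrier G \<times> carrier G. d x y \<le> r}"
proof -
  have "openin (prod_topology T T) {(x, y) \<in> carrier G \<times> carrier G. r < d x y}"
    using topometric by (simp add: Polish_topometric_group_def)
  then have "closedin (prod_topology T T)
     (topspace (prod_topology T T) - {(x, y) \<in> carrier G \<times> carrier G. r < d x y})"
    by (rule closedin_diff[OF closedin_topspace])
  also have "topspace (prod_topology T T) - {(x, y) \<in> carrier G \<times> carrier G. r < d x y}
      = {(x, y) \<in> carrier G \<times> carrier G. d x y \<le> r}"
    by auto
  finally show ?thesis .
qed

definition conj_tuple :: "nat \<Rightarrow> 'a \<Rightarrow> (nat \<Rightarrow> 'a) \<Rightarrow> (nat \<Rightarrow> 'a)" where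
  "conj_tuple n k z = (\<lambda>i\<in>{..<n}. k \<otimes> z i \<otimes> inv k)"

lemma topspace_tuples [simp]: "topspace (tuples_top T n) = {..<n} \<rightarrow>\<^sub>E carrier G"
  by (simp add: tuples_top_def)

lemma tuple_mem: "z \<in> {..<n} \<rightarrow>\<^sub>E carrier G \<Longrightarrow> i < n \<Longrightarrow> z i \<in> carrier G"
  by auto

text \<open>The distance of empty tuples is 0, so for \<open>n = 0\<close> and negative
  \<open>r\<close> only the right-hand side would hold.\<close>

lemma sup_dist_le_iff: "n \<noteq> 0 \<or> 0 \<le> r \<Longrightarrow> sup_dist d n x y \<le> r \<longleftrightarrow> (\<forall>i<n. d (x i) (y i) \<le> r)"
  by (cases "n = 0") (auto simp: sup_dist_def lessThan_empty_iff)

lemma sup_dist_less_iff: "0 < r \<Longrightarrow> sup_dist d n x y < r \<longleftrightarrow> (\<forall>i<n. d (x i) (y i) < r)"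
  by (cases "n = 0") (auto simp: sup_dist_def lessThan_empty_iff)

lemma isometric_action_tuples:
  "isometric_action G T (tuples_top T n) (sup_dist d n) (conj_tuple n)"
proof (unfold_locales, goal_cases)
  case 1
  have "finite {i \<in> {..<n}. \<not> (\<exists>a. topspace T \<subseteq> {a})}" by simp
  then show ?case
    unfolding tuples_top_def completely_metrizable_space_product_topology
    using completely_metrizable_T countable_finite by blast
next
  case (2 g z)
  then show ?case by (auto simp: conj_tuple_def)
next
  case (3 z)
  have "conj_tuple n \<one> z i = z i" for i
    using 3 by (cases "i < n") (simp_all add: conj_tuple_def tuple_mem PiE_arb[of z "{..<n}"])
  then show ?case by blast
next
  case (4 g h z)
  have "conj_tuple n (g \<otimes> h) z i = conj_tuple n g (conj_tuple n h z) i" for i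
    using 4 by (cases "i < n") (simp_all add: conj_tuple_def tuple_mem m_assoc inv_mult_group)
  then show ?case by blast
next
  case (5 z)
  have "continuous_map T T (\<lambda>k. k \<otimes> z i \<otimes> inv k)" if "i < n" for i
  proof -
    have id: "continuous_map T T (\<lambda>k. k)" by simp
    have "continuous_map T T (\<lambda>k. z i)" using 5 that by (simp add: tuple_mem)
    then show ?thesis by (rule continuous_mult[OF continuous_mult[OF id] continuous_inv[OF id]])
  qed
  then show ?case
    unfolding tuples_top_def conj_tuple_def continuous_map_componentwise
    by (simp add: image_subset_iff)
next
  case (6 z)
  then show ?case by (auto simp: sup_dist_def image_constant_conv PiE_iff)
next
  case (7 x y)
  then show ?case
    unfolding sup_dist_def by (metis (no_types, lifting) d.commute image_cong lessThan_iff)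
next
  case (8 x y z)
  have nonneg: "0 \<le> sup_dist d n x y" for x y
  proof (cases "n = 0")
    case False
    then have "d (x 0) (y 0) \<le> sup_dist d n x y"
      using sup_dist_le_iff[of n "sup_dist d n x y" x y] by blast
    then show ?thesis using order_trans[OF d.nonneg] by blast
  qed (simp add: sup_dist_def)
  show ?case
  proof (subst sup_dist_le_iff)
    show "n \<noteq> 0 \<or> 0 \<le> sup_dist d n x y + sup_dist d n y z" using nonneg by (simp add: add_nonneg_nonneg)
    show "\<forall>i<n. d (x i) (z i) \<le> sup_dist d n x y + sup_dist d n y z"
    proof (intro allI impI)
      fix i assume i: "i < n"
      have "d (x i) (z i) \<le> d (x i) (y i) + d (y i) (z i)"
        using 8 i by (intro d.triangle) (auto dest: tuple_mem)
      moreover have "d (x i) (y i) \<le> sup_dist d n x y" "d (y i) (z i) \<le> sup_dist d n y z"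
        using i sup_dist_le_iff[of n "sup_dist d n x y" x y] sup_dist_le_iff[of n "sup_dist d n y z" y z]
        by auto
      ultimately show "d (x i) (z i) \<le> sup_dist d n x y + sup_dist d n y z" by linarith
    qed
  qed
next
  case (9 g x y)
  then have "d (conj_tuple n g x i) (conj_tuple n g y i) = d (x i) (y i)" if "i < n" for i
    using that by (simp add: conj_tuple_def d_invariant tuple_mem)
  then have "(\<lambda>i. d (conj_tuple n g x i) (conj_tuple n g y i)) ` {..<n} = (\<lambda>i. d (x i) (y i)) ` {..<n}"
    by (intro image_cong) auto
  then show ?case unfolding sup_dist_def by (simp only:)
next
  case (10 r)
  let ?Z = "tuples_top T n"
  have coord: "closedin (prod_topology ?Z ?Z) {(x, y) \<in> topspace ?Z \<times> topspace ?Z. d (x i) (y i) \<le> r}"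
    if "i < n" for i
  proof -
    have "continuous_map (prod_topology ?Z ?Z) (prod_topology T T) (\<lambda>p. (fst p i, snd p i))"
    proof (rule continuous_map_pairedI)
      have proj: "continuous_map ?Z T (\<lambda>z. z i)"
        unfolding tuples_top_def using that by (intro continuous_map_product_projection) simp
      show "continuous_map (prod_topology ?Z ?Z) T (\<lambda>p. fst p i)"
        using continuous_map_compose[OF continuous_map_fst proj] by (simp add: o_def)
      show "continuous_map (prod_topology ?Z ?Z) T (\<lambda>p. snd p i)"
        using continuous_map_compose[OF continuous_map_snd proj] by (simp add: o_def)
    qed
    from closedin_continuous_map_preimage[OF this closedin_d_le[of r]]
    have "closedin (prod_topology ?Z ?Z) {p \<in> topspace (prod_topology ?Z ?Z).
        (fst p i, snd p i) \<in> {(x, y) \<in> carrier G \<times> carrier G. d x y \<le> r}}" .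
    also have "{p \<in> topspace (prod_topology ?Z ?Z). (fst p i, snd p i) \<in> {(x, y) \<in> carrier G \<times> carrier G. d x y \<le> r}}
      = {(x, y) \<in> topspace ?Z \<times> topspace ?Z. d (x i) (y i) \<le> r}"
    proof (rule Set.set_eqI)
      fix p
      show "p \<in> {p \<in> topspace (prod_topology ?Z ?Z). (fst p i, snd p i) \<in> {(x, y) \<in> carrier G \<times> carrier G. d x y \<le> r}}
        \<longleftrightarrow> p \<in> {(x, y) \<in> topspace ?Z \<times> topspace ?Z. d (x i) (y i) \<le> r}"
        using that by (cases p) (simp add: tuple_mem cong: conj_cong)
    qed
    finally show ?thesis .
  qed
  \<comment> \<open>For \<open>n = 0\<close> the intersection over the coordinates is empty and does
    not describe the sublevel set.\<close>
  show ?case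
  proof (cases "n = 0")
    case True
    then have "{(x, y) \<in> topspace ?Z \<times> topspace ?Z. sup_dist d n x y \<le> r}
        = (if 0 \<le> r then topspace (prod_topology ?Z ?Z) else {})"
      by (auto simp: sup_dist_def)
    then show ?thesis by (simp only: closedin_topspace closedin_empty simp_thms split: if_split)
  next
    case False
    then have "closedin (prod_topology ?Z ?Z)
        (\<Inter>i\<in>{..<n}. {(x, y) \<in> topspace ?Z \<times> topspace ?Z. d (x i) (y i) \<le> r})"
      using coord by (intro closedin_INT) auto
    moreover have "(\<Inter>i\<in>{..<n}. {(x, y) \<in> topspace ?Z \<times> topspace ?Z. d (x i) (y i) \<le> r})
       = {(x, y) \<in> topspace ?Z \<times> topspace ?Z. sup_dist d n x y \<le> r}"
      using False by (auto simp: sup_dist_le_iff)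
    ultimately show ?thesis by simp
  qed
qed

end

section \<open>Category in spaces of tuples, one coordinate at a time\<close>

context topometric_group
begin

text \<open>Splitting off the last coordinate lets results on products of two spaces pass to
  tuples.\<close>

lemma homeomorphic_map_tuples_Suc:
  "homeomorphic_map (prod_topology (tuples_top T n) T) (tuples_top T (Suc n)) (\<lambda>(z, x). z(n := x))"
proof (rule homeomorphic_maps_imp_map)
  show "homeomorphic_maps (prod_topology (tuples_top T n) T) (tuples_top T (Suc n))
          (\<lambda>(z, x). z(n := x)) (\<lambda>y. (restrict y {..<n}, y n))"
    unfolding homeomorphic_maps_def
  proof (intro conjI ballI)
    show "continuous_map (prod_topology (tuples_top T n) T) (tuples_top T (Suc n)) (\<lambda>(z, x). z(n := x))"
      unfolding tuples_top_def continuous_map_componentwise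
    proof (intro conjI ballI)
      show "(\<lambda>(z, x). z(n := x)) ` topspace (prod_topology (product_topology (\<lambda>_. T) {..<n}) T) \<subseteq> extensional {..<Suc n}"
        by (auto simp: PiE_iff extensional_def)
      fix i assume i: "i \<in> {..<Suc n}"
      show "continuous_map (prod_topology (product_topology (\<lambda>_. T) {..<n}) T) T (\<lambda>p. (case p of (z, x) \<Rightarrow> z(n := x)) i)"
      proof (cases "i = n")
        case True
        then show ?thesis by (simp add: case_prod_unfold continuous_map_snd)
      next
        case False
        then have "continuous_map (product_topology (\<lambda>_. T) {..<n}) T (\<lambda>z. z i)"
          using i by (intro continuous_map_product_projection) auto
        from continuous_map_compose[OF continuous_map_fst this]
        show ?thesis using False by (simp add: case_prod_unfold o_def)
      qed
    qed
    show "continuous_map (tuples_top T (Suc n)) (prod_topology (tuples_top T n) T) (\<lambda>y. (restrict y {..<n}, y n))"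
    proof (rule continuous_map_pairedI)
      show "continuous_map (tuples_top T (Suc n)) (tuples_top T n) (\<lambda>y. restrict y {..<n})"
        unfolding tuples_top_def
        by (subst continuous_map_componentwise) (auto intro!: continuous_map_product_projection)
      show "continuous_map (tuples_top T (Suc n)) T (\<lambda>y. y n)"
        unfolding tuples_top_def by (rule continuous_map_product_projection) simp
    qed
  next
    fix p assume "p \<in> topspace (prod_topology (tuples_top T n) T)"
    then show "(\<lambda>y. (restrict y {..<n}, y n)) ((\<lambda>(z, x). z(n := x)) p) = p"
      by (fastforce simp: PiE_iff extensional_def)
  next
    fix y assume "y \<in> topspace (tuples_top T (Suc n))"
    then show "(\<lambda>(z, x). z(n := x)) (restrict y {..<n}, y n) = y"
      by (fastforce simp: PiE_iff extensional_def less_Suc_eq)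
  qed
qed

lemma has_countable_pi_base_tuples: "has_countable_pi_base (tuples_top T n)"
proof (induction n)
  case 0
  have top: "topspace (tuples_top T 0) = {\<lambda>_. undefined}" by simp
  show ?case
  proof (rule has_countable_pi_baseI[where \<B> = "{topspace (tuples_top T 0)}"])
    show "\<exists>V\<in>{topspace (tuples_top T 0)}. V \<subseteq> U" if "openin (tuples_top T 0) U" "U \<noteq> {}" for U
      using that(2) openin_subset[OF that(1)] unfolding top by blast
    show "openin (tuples_top T 0) V \<and> V \<noteq> {}" if "V \<in> {topspace (tuples_top T 0)}" for V
    proof -
      have "V = topspace (tuples_top T 0)" using that by blast
      then show ?thesis by (metis openin_topspace top insert_not_empty)
    qed
  qed simp
next
  case (Suc n)
  show ?case
    by (rule has_countable_pi_base_homeomorphic[OF homeomorphic_map_tuples_Suc])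
       (rule has_countable_pi_base_prod[OF Suc has_countable_pi_base_T])
qed

lemma Kuratowski_Ulam_tuples:
  assumes "comeagre_in (tuples_top T (Suc n)) S"
  shows "comeagre_in (tuples_top T n)
    {z \<in> topspace (tuples_top T n). comeagre_in T {x \<in> carrier G. z(n := x) \<in> S}}"
proof -
  let ?P = "prod_topology (tuples_top T n) T"
  obtain g where g: "homeomorphic_maps ?P (tuples_top T (Suc n)) (\<lambda>(z, x). z(n := x)) g"
    using homeomorphic_map_tuples_Suc[of n] unfolding homeomorphic_map_maps by (elim exE)
  have "homeomorphic_map (tuples_top T (Suc n)) ?P g"
    using homeomorphic_maps_sym[THEN iffD1, OF g] by (rule homeomorphic_maps_imp_map)
  then have "comeagre_in ?P (g ` S)" using assms by (rule comeagre_in_homeomorphic_image)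
  then have *: "comeagre_in (tuples_top T n) {z \<in> topspace (tuples_top T n). comeagre_in T {x \<in> topspace T. (z, x) \<in> g ` S}}"
    by (rule Kuratowski_Ulam[OF has_countable_pi_base_T])
  have "z(n := x) \<in> S" if zx: "(z, x) \<in> g ` S" for z x
  proof -
    obtain y where y: "y \<in> S" "g y = (z, x)" using zx by (metis imageE)
    then have "y \<in> topspace (tuples_top T (Suc n))" using assms unfolding comeagre_in_def by blast
    then have "(\<lambda>(z, x). z(n := x)) (g y) = y" using g unfolding homeomorphic_maps_def by blast
    then show ?thesis using y by simp
  qed
  then have "{x \<in> topspace T. (z, x) \<in> g ` S} \<subseteq> {x \<in> carrier G. z(n := x) \<in> S}" for z by auto
  then have "comeagre_in T {x \<in> carrier G. z(n := x) \<in> S}"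
    if "comeagre_in T {x \<in> topspace T. (z, x) \<in> g ` S}" for z
    using comeagre_in_superset[OF that] by simp
  then show ?thesis by (intro comeagre_in_superset[OF *]) auto
qed

text \<open>The extension property is demanded of every member of \<open>S n\<close>, not of almost
  every one, so that a generic tuple can be prolonged indefinitely by successive choices.\<close>

definition hereditarily_comeagre :: "(nat \<Rightarrow> (nat \<Rightarrow> 'a) set) \<Rightarrow> bool" where
  "hereditarily_comeagre S \<longleftrightarrow> (\<forall>n. comeagre_in (tuples_top T n) (S n) \<and>
     (\<forall>z\<in>S n. comeagre_in T {x \<in> carrier G. z(n := x) \<in> S (Suc n)}))"

text \<open>Stage \<open>j + 1\<close> discards the tuples with too few extensions inside stage
  \<open>j\<close>, a meagre set by Kuratowski-Ulam. Discarding may spoil other tuples, so it is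
  iterated; the intersection of all stages is stable because countable intersections of comeagre
  sets are comeagre.\<close>

lemma hereditarily_comeagre_subset:
  assumes "\<And>n. comeagre_in (tuples_top T n) (R n)"
  obtains S where "hereditarily_comeagre S" "\<And>n. S n \<subseteq> R n"
proof -
  define Q where "Q = rec_nat R (\<lambda>_ Q n. Q n \<inter>
     {z \<in> topspace (tuples_top T n). comeagre_in T {x \<in> carrier G. z(n := x) \<in> Q (Suc n)}})"
  have Q0: "Q 0 = R" and QSuc: "Q (Suc j) n = Q j n \<inter>
     {z \<in> topspace (tuples_top T n). comeagre_in T {x \<in> carrier G. z(n := x) \<in> Q j (Suc n)}}" for j n
    by (simp_all add: Q_def)
  have Q: "comeagre_in (tuples_top T n) (Q j n)" for j n
    by (induction j arbitrary: n)
       (simp_all only: Q0 QSuc assms comeagre_in_Int Kuratowski_Ulam_tuples)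
  define S where "S n = topspace (tuples_top T n) \<inter> (\<Inter>j. Q j n)" for n
  have "comeagre_in (tuples_top T n) (S n)" for n
    unfolding S_def using Q by (intro comeagre_in_INT) auto
  moreover have "comeagre_in T {x \<in> carrier G. z(n := x) \<in> S (Suc n)}" if z: "z \<in> S n" for z n
  proof -
    have "comeagre_in T {x \<in> carrier G. z(n := x) \<in> Q j (Suc n)}" for j
      using z QSuc[of j n] unfolding S_def by blast
    then have "comeagre_in T (topspace T \<inter> (\<Inter>j. {x \<in> carrier G. z(n := x) \<in> Q j (Suc n)}))"
      by (intro comeagre_in_INT) auto
    moreover have "z(n := x) \<in> topspace (tuples_top T (Suc n))" if "x \<in> carrier G" for x
      using that z unfolding S_def by (auto simp: PiE_iff extensional_def less_Suc_eq)
    ultimately show ?thesis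
      unfolding S_def by (elim comeagre_in_superset) auto
  qed
  moreover have "S n \<subseteq> R n" for n unfolding S_def using Q0 by blast
  ultimately show ?thesis using that unfolding hereditarily_comeagre_def by blast
qed

text \<open>Approximate transitivity is applied to the points \<open>(z, x)\<close> and \<open>(z, y)\<close> of \<open>G\<^sup>n\<^sup>+\<^sup>1\<close>: an element
  that nearly moves the first to the second nearly fixes \<open>z\<close> and nearly conjugates \<open>x\<close> to \<open>y\<close>.\<close>

lemma extend_generic_tuple:
  assumes S: "hereditarily_comeagre S"
    and SR: "\<And>n. S n \<subseteq> isometric_action.locally_nonmeagre_orbits G T (tuples_top T n) (sup_dist d n) (conj_tuple n)"
    and z: "z \<in> S n"
    and U: "openin T U" and X: "X \<subseteq> carrier G" "\<not> meagre_in T (X \<inter> U)"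
    and Y: "Y \<subseteq> carrier G"
       "\<And>V. openin T V \<Longrightarrow> V \<noteq> {} \<Longrightarrow> V \<subseteq> U \<Longrightarrow> \<not> meagre_in T (Y \<inter> V)"
    and W: "openin T W" "\<one> \<in> W" and \<eta>: "0 < \<eta>"
  obtains x y f where "x \<in> X" "y \<in> Y" "f \<in> W" "z(n := x, Suc n := y) \<in> S (Suc (Suc n))"
    "\<And>i. i < n \<Longrightarrow> d (f \<otimes> z i \<otimes> inv f) (z i) < \<eta>" "d (f \<otimes> x \<otimes> inv f) y < \<eta>"
proof -
  interpret act: isometric_action G T "tuples_top T (Suc n)" "sup_dist d (Suc n)" "conj_tuple (Suc n)"
    by (rule isometric_action_tuples)
  have S_comeagre: "comeagre_in (tuples_top T n) (S n)" for n
    using S unfolding hereditarily_comeagre_def by blast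
  have S_ext: "comeagre_in T {x \<in> carrier G. z(n := x) \<in> S (Suc n)}" if "z \<in> S n" for z n
    using S that unfolding hereditarily_comeagre_def by blast
  have "\<not> meagre_in T ((X \<inter> U) \<inter> {x \<in> carrier G. z(n := x) \<in> S (Suc n)})"
    using X by (intro comeagre_Int_nonmeagre[OF S_ext[OF z]]) auto
  then have "(X \<inter> U) \<inter> {x \<in> carrier G. z(n := x) \<in> S (Suc n)} \<noteq> {}"
    using meagre_in_empty by metis
  then obtain x where x: "x \<in> X" "x \<in> U" "x \<in> carrier G" "z(n := x) \<in> S (Suc n)" by blast
  obtain N where N: "openin (tuples_top T (Suc n)) N" "z(n := x) \<in> N"
    "\<And>z'. z' \<in> S (Suc n) \<Longrightarrow> z' \<in> N \<Longrightarrow> \<exists>f\<in>W. sup_dist d (Suc n) (conj_tuple (Suc n) f (z(n := x))) z' < \<eta>"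
    using act.approximate_transitivity[OF S_comeagre SR x(4) W \<eta>] by metis
  have zT: "z \<in> topspace (tuples_top T n)" using z S_comeagre[of n] unfolding comeagre_in_def by blast
  have "continuous_map T (tuples_top T (Suc n)) ((\<lambda>(z, x). z(n := x)) \<circ> (\<lambda>y. (z, y)))"
    using homeomorphic_imp_continuous_map[OF homeomorphic_map_tuples_Suc, of n] zT
    by (intro continuous_map_compose[where X' = "prod_topology (tuples_top T n) T"] continuous_map_pairedI)
       (simp_all add: continuous_map_id[unfolded id_def])
  then have "openin T {y \<in> topspace T. ((\<lambda>(z, x). z(n := x)) \<circ> (\<lambda>y. (z, y))) y \<in> N}"
    using N(1) openin_continuous_map_preimage by blast
  then have o: "openin T (U \<inter> {y \<in> carrier G. z(n := y) \<in> N})"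
    using U by (intro openin_Int) (simp_all add: o_def)
  \<comment> \<open>This open set depends on \<open>x\<close> through \<open>N\<close>. That is why
    \<open>Y\<close> has to be nonmeagre in all nonempty open subsets of \<open>U\<close>, while for
    \<open>X\<close> it is enough to be nonmeagre in \<open>U\<close>.\<close>
  have "\<not> meagre_in T (Y \<inter> (U \<inter> {y \<in> carrier G. z(n := y) \<in> N}))"
    using x N(2) by (intro Y(2)[OF o]) auto
  \<comment> \<open>The first comeagre condition lets transitivity be applied to
    \<open>z(n := y)\<close>; the second keeps the tuple with both new entries generic, so that the
    construction can go on.\<close>
  then have "\<not> meagre_in T ((Y \<inter> (U \<inter> {y \<in> carrier G. z(n := y) \<in> N})) \<inter>
       ({y \<in> carrier G. z(n := y) \<in> S (Suc n)} \<inter>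
        {y \<in> carrier G. (z(n := x))(Suc n := y) \<in> S (Suc (Suc n))}))"
    using Y(1) by (intro comeagre_Int_nonmeagre[OF comeagre_in_Int[OF S_ext[OF z] S_ext[OF x(4)]]]) auto
  then obtain y where y: "y \<in> Y" "y \<in> carrier G" "z(n := y) \<in> N" "z(n := y) \<in> S (Suc n)"
    "z(n := x, Suc n := y) \<in> S (Suc (Suc n))"
    using meagre_in_empty[of T] by (smt (verit, ccfv_threshold) IntE all_not_in_conv mem_Collect_eq)
  obtain f where f: "f \<in> W" "sup_dist d (Suc n) (conj_tuple (Suc n) f (z(n := x))) (z(n := y)) < \<eta>"
    using N(3)[OF y(4,3)] by blast
  then have *: "d (conj_tuple (Suc n) f (z(n := x)) i) ((z(n := y)) i) < \<eta>" if "i < Suc n" for i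
    using sup_dist_less_iff[OF \<eta>] that by blast
  have "d (f \<otimes> z i \<otimes> inv f) (z i) < \<eta>" if "i < n" for i
    using *[of i] that by (simp add: conj_tuple_def)
  moreover have "d (f \<otimes> x \<otimes> inv f) y < \<eta>"
    using *[of n] by (simp add: conj_tuple_def)
  ultimately show ?thesis using that x(1) y(1,5) f(1) by blast
qed

end

section \<open>The Cantor scheme\<close>

abbreviation cantor_space :: "(nat \<Rightarrow> bool) topology" where
  "cantor_space \<equiv> product_topology (\<lambda>_. discrete_topology UNIV) UNIV"

context topometric_group
begin

primrec branch :: "(nat \<Rightarrow> 'a) \<Rightarrow> (nat \<Rightarrow> bool) \<Rightarrow> nat \<Rightarrow> 'a" where
  "branch F a 0 = \<one>"
| "branch F a (Suc m) = branch F a m \<otimes> (if a m then F m else \<one>)"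

lemma branch_closed: "(\<And>m. F m \<in> carrier G) \<Longrightarrow> branch F a m \<in> carrier G"
  by (induction m) auto

lemma branch_cong: "(\<And>i. i < m \<Longrightarrow> a i = b i) \<Longrightarrow> branch F a m = branch F b m"
  by (induction m) auto

lemma continuous_branch:
  assumes "\<And>m. F m \<in> carrier G"
  shows "continuous_map cantor_space T (\<lambda>a. branch F a m)"
proof (induction m)
  case (Suc m)
  have "continuous_map cantor_space (discrete_topology UNIV) (\<lambda>a. a m)"
    by (rule continuous_map_product_projection) simp
  moreover have "continuous_map (discrete_topology UNIV) T (\<lambda>c. if c then F m else \<one>)"
    using assms by (auto simp: continuous_map_from_discrete_topology)
  ultimately have "continuous_map cantor_space T ((\<lambda>c. if c then F m else \<one>) \<circ> (\<lambda>a. a m))"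
    by (rule continuous_map_compose)
  then show ?case
    using continuous_mult[OF Suc] by (simp add: o_def)
qed simp

text \<open>Closed sublevel sets of \<open>d\<close> are closed for the product of \<open>T\<close>
  with itself, so a bound along the tail from \<open>N\<close> on survives in the limit of the
  conjugates.\<close>

lemma d_conj_limit:
  assumes h: "limitin T H h sequentially" and H: "\<And>n. H n \<in> carrier G"
    and x: "x \<in> carrier G" and y: "y \<in> carrier G"
    and le: "\<And>n. d y (H (n + N) \<otimes> x \<otimes> inv (H (n + N))) \<le> r"
  shows "d y (h \<otimes> x \<otimes> inv h) \<le> r"
proof -
  have id: "continuous_map T T (\<lambda>k. k)" by simp
  have "continuous_map T T (\<lambda>k. x)" using x by simp
  then have "continuous_map T T (\<lambda>k. k \<otimes> x \<otimes> inv k)"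
    by (rule continuous_mult[OF continuous_mult[OF id] continuous_inv[OF id]])
  then have "limitin T ((\<lambda>k. k \<otimes> x \<otimes> inv k) \<circ> H) (h \<otimes> x \<otimes> inv h) sequentially"
    using h by (rule continuous_map_limit)
  then have "limitin T (\<lambda>n. H n \<otimes> x \<otimes> inv (H n)) (h \<otimes> x \<otimes> inv h) sequentially"
    by (simp add: o_def)
  then have lim: "limitin T (\<lambda>n. H (n + N) \<otimes> x \<otimes> inv (H (n + N))) (h \<otimes> x \<otimes> inv h) sequentially"
    by (rule limitin_sequentially_offset)
  have "limitin (prod_topology T T) (\<lambda>n. (y, H (n + N) \<otimes> x \<otimes> inv (H (n + N)))) (y, h \<otimes> x \<otimes> inv h) sequentially"
    using lim y by (simp add: limitin_pairwise o_def limitin_const)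
  then have "(y, h \<otimes> x \<otimes> inv h) \<in> {(x, y) \<in> carrier G \<times> carrier G. d x y \<le> r}"
    by (rule limitin_closedin[OF _ closedin_d_le]) (use le x y H in \<open>auto intro!: always_eventually\<close>)
  then show ?thesis by simp
qed

text \<open>Level \<open>m\<close> adds two entries \<open>x\<close>, \<open>y\<close> to a generic
  tuple and an \<open>F m\<close> nearly conjugating \<open>x\<close> to \<open>y\<close>. If
  \<open>a\<close> and \<open>b\<close> split at \<open>m\<close>, their products just after that
  level are \<open>p \<otimes> F m\<close> and \<open>p\<close> with the same \<open>p\<close>, so
  the first conjugates \<open>x\<close> to nearly what the second makes of \<open>y\<close>.\<close>

lemma Cantor_scheme:
  assumes S: "hereditarily_comeagre S"
    and SR: "\<And>n. S n \<subseteq> isometric_action.locally_nonmeagre_orbits G T (tuples_top T n) (sup_dist d n) (conj_tuple n)"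
    and U: "\<And>m. openin T (U m)"
    and X: "\<And>m. X m \<subseteq> carrier G" "\<And>m. \<not> meagre_in T (X m \<inter> U m)"
    and Y: "\<And>m. Y m \<subseteq> carrier G"
       "\<And>m V. openin T V \<Longrightarrow> V \<noteq> {} \<Longrightarrow> V \<subseteq> U m \<Longrightarrow> \<not> meagre_in T (Y m \<inter> V)"
    and \<epsilon>: "\<And>m. 0 < \<epsilon> m"
  obtains h where "continuous_map cantor_space T h"
    "\<And>m a b. (\<And>i. i < m \<Longrightarrow> a i = b i) \<Longrightarrow> a m \<Longrightarrow> \<not> b m \<Longrightarrow>
       \<exists>x\<in>X m. \<exists>y\<in>Y m. d (h a \<otimes> x \<otimes> inv (h a)) (h b \<otimes> y \<otimes> inv (h b)) < \<epsilon> m"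
proof -
  obtain \<rho> where \<rho>: "Metric_space (carrier G) \<rho>" "Metric_space.mcomplete (carrier G) \<rho>"
    "Metric_space.mtopology (carrier G) \<rho> = T"
    using obtain_metric by metis
  interpret R: Metric_space "carrier G" \<rho> by fact
  \<comment> \<open>Three errors of at most \<open>\<eta> m\<close> must fit below
    \<open>\<epsilon> m\<close>: one for the conjugation by \<open>F m\<close>, and one for the
    passage to the limit along each of the two branches. The halving bounds the sum of all errors
    after level \<open>m\<close> by \<open>\<eta> m\<close>.\<close>
  define \<eta> where "\<eta> = rec_nat (\<epsilon> 0 / 3) (\<lambda>m e. min (e / 2) (\<epsilon> (Suc m) / 3))"
  have \<eta>_Suc: "\<eta> (Suc m) \<le> \<eta> m / 2" for m by (simp add: \<eta>_def)
  have \<eta>_le: "3 * \<eta> m \<le> \<epsilon> m" for m by (cases m) (simp_all add: \<eta>_def)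
  have \<eta>_pos: "0 < \<eta> m" for m by (induction m) (use \<epsilon> in \<open>simp_all add: \<eta>_def\<close>)

  \<comment> \<open>\<open>B\<close> collects the products of subwords of the \<open>F i\<close> chosen so far; later elements nearly
    commute with the entries of \<open>z\<close>, so they hardly disturb the conjugacies already arranged.\<close>
  define P where "P = (\<lambda>(m :: nat) (B, z, f :: 'a). finite B \<and> B \<subseteq> carrier G
      \<and> f \<in> carrier G \<and> z \<in> S (2 * m) \<and> (m = 0 \<longrightarrow> B = {\<one>}))"
  define Q where "Q = (\<lambda>m (B, z, f :: 'a) (B', z', f').
      B' = B \<union> (\<lambda>b. b \<otimes> f') ` B \<and> (\<forall>b\<in>B. \<rho> b (b \<otimes> f') < 1 / 2 ^ Suc m)
      \<and> (\<forall>i<2 * m. z' i = z i) \<and> z' (2 * m) \<in> X m \<and> z' (Suc (2 * m)) \<in> Y m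
      \<and> (\<forall>i<2 * m. d (f' \<otimes> z i \<otimes> inv f') (z i) < \<eta> m)
      \<and> d (f' \<otimes> z' (2 * m) \<otimes> inv f') (z' (Suc (2 * m))) < \<eta> m)"
  have "\<exists>s. \<forall>m. P m (s m) \<and> Q m (s m) (s (Suc m))"
  proof (rule dependent_nat_choice)
    have "comeagre_in (tuples_top T 0) (S 0)" using S unfolding hereditarily_comeagre_def by blast
    moreover have "completely_metrizable_space (tuples_top T 0)"
      using isometric_action.completely_metrizable_Z[OF isometric_action_tuples] .
    moreover have "topspace (tuples_top T 0) \<noteq> {}" by simp
    ultimately have "S 0 \<inter> topspace (tuples_top T 0) \<noteq> {}"
      using comeagre_meets_open openin_topspace by metis
    then obtain z where "z \<in> S 0" by blast
    then show "\<exists>x. P 0 x"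
      by (intro exI[of _ "({\<one>}, z, \<one>)"]) (simp add: P_def)
  next
    fix s m assume "P m s"
    then obtain B z f where s: "s = (B, z, f)" "finite B" "B \<subseteq> carrier G" "z \<in> S (2 * m)"
      unfolding P_def by (cases s) auto
    \<comment> \<open>Right multiplication by the new element must move each of the finitely many
      products in \<open>B\<close> little for \<open>\<rho>\<close>, which is in general not left
      invariant. All branches then converge at the same rate.\<close>
    define W where "W = topspace T \<inter> (\<Inter>b\<in>B. {w \<in> topspace T. b \<otimes> w \<in> R.mball b (1 / 2 ^ Suc m)})"
    have "openin T {w \<in> topspace T. b \<otimes> w \<in> R.mball b (1 / 2 ^ Suc m)}" if "b \<in> B" for b
    proof (rule openin_continuous_map_preimage)
      have "continuous_map T T (\<lambda>w. b)" using that s by auto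
      then show "continuous_map T T (\<lambda>w. b \<otimes> w)" by (rule continuous_mult) simp
      show "openin T (R.mball b (1 / 2 ^ Suc m))" using R.openin_mball \<rho>(3) by metis
    qed
    then have Wo: "openin T W"
      unfolding W_def using s(2) by (cases "B = {}") (auto intro!: openin_Int openin_INT simp del: topspace_T)
    have W1: "\<one> \<in> W" unfolding W_def using s(3) by auto
    obtain x y f' where f': "x \<in> X m" "y \<in> Y m" "f' \<in> W"
      "z(2 * m := x, Suc (2 * m) := y) \<in> S (Suc (Suc (2 * m)))"
      "\<And>i. i < 2 * m \<Longrightarrow> d (f' \<otimes> z i \<otimes> inv f') (z i) < \<eta> m" "d (f' \<otimes> x \<otimes> inv f') y < \<eta> m"
    proof (rule extend_generic_tuple[OF S SR s(4) U X Y(1) _ Wo W1 \<eta>_pos])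
      show "\<not> meagre_in T (Y m \<inter> V)" if "openin T V" "V \<noteq> {}" "V \<subseteq> U m" for V
        using that by (rule Y(2))
    qed (rule that)
    have f'B: "\<rho> b (b \<otimes> f') < 1 / 2 ^ Suc m" if "b \<in> B" for b
      using f'(3) that unfolding W_def by auto
    let ?s = "(B \<union> (\<lambda>b. b \<otimes> f') ` B, z(2 * m := x, Suc (2 * m) := y), f')"
    have f'G: "f' \<in> carrier G" using f'(3) unfolding W_def by auto
    then have "P (Suc m) ?s"
      unfolding P_def using s f'(4) by auto
    moreover have "Q m s ?s"
      unfolding Q_def s(1) using f' f'B by auto
    ultimately show "\<exists>y. P (Suc m) y \<and> Q m s y" by blast
  qed
  then obtain s where s: "\<And>m. P m (s m)" "\<And>m. Q m (s m) (s (Suc m))" by blast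
  define B where "B m = fst (s m)" for m
  define z where "z m = fst (snd (s m))" for m
  \<comment> \<open>The element chosen at step \<open>m\<close> is stored in stage
    \<open>m + 1\<close>; the one in stage 0 is a dummy.\<close>
  define F where "F m = snd (snd (s (Suc m)))" for m
  have s_eq: "s m = (B m, z m, snd (snd (s m)))" for m by (simp add: B_def z_def)
  have s_Suc: "s (Suc m) = (B (Suc m), z (Suc m), F m)" for m by (simp add: B_def z_def F_def)
  have P: "B m \<subseteq> carrier G" "z m \<in> S (2 * m)" for m
    using s(1)[of m] by (subst (asm) s_eq; simp add: P_def)+
  have B0: "B 0 = {\<one>}"
    using s(1)[of 0] by (subst (asm) s_eq) (simp add: P_def)
  have F: "F m \<in> carrier G" for m
    using s(1)[of "Suc m"] unfolding s_Suc by (simp add: P_def)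
  have Q: "B (Suc m) = B m \<union> (\<lambda>b. b \<otimes> F m) ` B m"
    "\<And>b. b \<in> B m \<Longrightarrow> \<rho> b (b \<otimes> F m) < 1 / 2 ^ Suc m"
    "\<And>i. i < 2 * m \<Longrightarrow> z (Suc m) i = z m i"
    "z (Suc m) (2 * m) \<in> X m" "z (Suc m) (Suc (2 * m)) \<in> Y m"
    "\<And>i. i < 2 * m \<Longrightarrow> d (F m \<otimes> z m i \<otimes> inv (F m)) (z m i) < \<eta> m"
    "d (F m \<otimes> z (Suc m) (2 * m) \<otimes> inv (F m)) (z (Suc m) (Suc (2 * m))) < \<eta> m" for m
    using s(2)[of m] unfolding s_Suc by (subst (asm) s_eq; simp add: Q_def)+

  have H: "branch F a m \<in> carrier G" for a m by (rule branch_closed[OF F])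
  have HB: "branch F a m \<in> B m" for a m
    by (induction m) (simp_all add: B0 Q(1) H)
  have H_step: "\<rho> (branch F a m) (branch F a (Suc m)) \<le> 1 / 2 ^ Suc m" for a m
    using Q(2)[OF HB[of a m]] H[of a m] by (cases "a m") simp_all
  have "\<exists>l\<in>carrier G. limitin T (branch F a) l sequentially \<and> (\<forall>m. \<rho> (branch F a m) l \<le> 1 / 2 ^ m)" for a
    using R.geometric_Cauchy_limit[OF \<rho>(2) H[of a] H_step[of a]] unfolding \<rho>(3) by (metis)
  then obtain h where h: "\<And>a. h a \<in> carrier G" "\<And>a. limitin T (branch F a) (h a) sequentially"
    "\<And>a m. \<rho> (branch F a m) (h a) \<le> 1 / 2 ^ m"
    by metis
  have "continuous_map cantor_space R.mtopology h"
  proof (rule R.continuous_map_uniform_limit_alt[where F = sequentially])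
    show "\<forall>\<^sub>F m in sequentially. continuous_map cantor_space R.mtopology (\<lambda>a. branch F a m)"
      unfolding \<rho>(3) by (intro always_eventually allI continuous_branch F)
    show "h \<in> topspace cantor_space \<rightarrow> carrier G" using h(1) by blast
    fix e :: real assume "0 < e"
    then have "\<forall>\<^sub>F m in sequentially. (1 / 2) ^ m < e"
      by (intro order_tendstoD(2)[OF LIMSEQ_power_zero]) auto
    then show "\<forall>\<^sub>F m in sequentially. \<forall>a\<in>topspace cantor_space. \<rho> (branch F a m) (h a) < e"
      by (rule eventually_mono) (metis h(3) le_less_trans power_one_over)
  qed simp
  then have h_cont: "continuous_map cantor_space T h" unfolding \<rho>(3) .

  have z_stable: "z (m + j) i = z m i" if "i < 2 * m" for i j m
    by (induction j) (use that Q(3) in auto)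
  have z_mem: "z m i \<in> carrier G" if "i < 2 * m" for i m
  proof -
    have "comeagre_in (tuples_top T (2 * m)) (S (2 * m))" using S unfolding hereditarily_comeagre_def by blast
    then have "z m \<in> {..<2 * m} \<rightarrow>\<^sub>E carrier G" using P(2)[of m] unfolding comeagre_in_def by auto
    then show ?thesis using that by (rule tuple_mem)
  qed
  define c where "c a m p = branch F a m \<otimes> p \<otimes> inv (branch F a m)" for a m p
  have c_mem: "c a m p \<in> carrier G" if "p \<in> carrier G" for a m p
    using that H by (simp add: c_def)
  \<comment> \<open>Conjugation by the common part of the product is isometric, so only the
    displacement of the entry by \<open>F m\<close> counts.\<close>
  have c_step: "d (c a m (z m i)) (c a (Suc m) (z m i)) \<le> \<eta> m" if "i < 2 * m" for a m i
  proof (cases "a m")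
    case True
    have "c a (Suc m) (z m i) = branch F a m \<otimes> (F m \<otimes> z m i \<otimes> inv (F m)) \<otimes> inv (branch F a m)"
      using True H F z_mem[OF that] by (simp add: c_def inv_mult_group m_assoc)
    then have "d (c a m (z m i)) (c a (Suc m) (z m i)) = d (z m i) (F m \<otimes> z m i \<otimes> inv (F m))"
      using H F z_mem[OF that] by (simp add: c_def d_invariant)
    then show ?thesis using Q(6)[OF that] d.commute by simp
  next
    case False
    then show ?thesis using H \<eta>_pos[of m] z_mem[OF that] by (simp add: c_def)
  qed
  \<comment> \<open>Halving gives \<open>\<eta> k \<le> 2 * \<eta> k - 2 * \<eta> (Suc k)\<close>,
    so the single steps telescope.\<close>
  have c_approx: "d (c a m (z m i)) (c a (j + m) (z m i)) \<le> 2 * \<eta> m - 2 * \<eta> (j + m)" if i: "i < 2 * m" for a m i j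
  proof (induction j)
    case 0
    then show ?case using c_mem z_mem[OF i] by simp
  next
    case (Suc j)
    have "d (c a m (z m i)) (c a (Suc j + m) (z m i))
        \<le> d (c a m (z m i)) (c a (j + m) (z m i)) + d (c a (j + m) (z m i)) (c a (Suc (j + m)) (z m i))"
      using d.triangle[OF c_mem c_mem c_mem] z_mem[OF i] by simp
    also have "d (c a (j + m) (z m i)) (c a (Suc (j + m)) (z m i)) \<le> \<eta> (j + m)"
      using c_step[of i "j + m" a] z_stable[OF i, of j] i by (simp add: add.commute)
    finally show ?case using Suc \<eta>_Suc[of "j + m"] by simp
  qed
  have h_approx: "d (c a m (z m i)) (h a \<otimes> z m i \<otimes> inv (h a)) \<le> 2 * \<eta> m" if i: "i < 2 * m" for a m i
  proof (rule d_conj_limit[OF h(2)[of a], where N = m])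
    fix j
    show "d (c a m (z m i)) (branch F a (j + m) \<otimes> z m i \<otimes> inv (branch F a (j + m))) \<le> 2 * \<eta> m"
      using c_approx[OF i, of a j] \<eta>_pos[of "j + m"] unfolding c_def by linarith
  qed (use H z_mem[OF i] c_mem in auto)

  show ?thesis
  proof (rule that[OF h_cont])
    fix m and a b :: "nat \<Rightarrow> bool"
    assume ab: "\<And>i. i < m \<Longrightarrow> a i = b i" "a m" "\<not> b m"
    let ?x = "z (Suc m) (2 * m)" and ?y = "z (Suc m) (Suc (2 * m))"
    have x: "?x \<in> carrier G" and y: "?y \<in> carrier G" using z_mem[of _ "Suc m"] by simp_all
    have bm: "branch F b m = branch F a m" using branch_cong[of m a b F] ab(1) by simp
    have "c a (Suc m) ?x = branch F a m \<otimes> (F m \<otimes> ?x \<otimes> inv (F m)) \<otimes> inv (branch F a m)"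
      using ab(2) H F x by (simp add: c_def inv_mult_group m_assoc)
    moreover have "c b (Suc m) ?y = branch F a m \<otimes> ?y \<otimes> inv (branch F a m)"
      using ab(3) H y by (simp add: c_def bm)
    ultimately have "d (c a (Suc m) ?x) (c b (Suc m) ?y) = d (F m \<otimes> ?x \<otimes> inv (F m)) ?y"
      using H F x y by (simp add: d_invariant)
    then have 1: "d (c a (Suc m) ?x) (c b (Suc m) ?y) < \<eta> m" using Q(7)[of m] by simp
    \<comment> \<open>The entries \<open>2 * m\<close> and \<open>2 * m + 1\<close> are present only
      from stage \<open>m + 1\<close> on; the error there is \<open>2 * \<eta> (Suc m)\<close>,
      which is at most \<open>\<eta> m\<close>.\<close>
    have 2: "d (c a (Suc m) ?x) (h a \<otimes> ?x \<otimes> inv (h a)) \<le> \<eta> m"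
      and 3: "d (c b (Suc m) ?y) (h b \<otimes> ?y \<otimes> inv (h b)) \<le> \<eta> m"
      using h_approx[of "2 * m" "Suc m" a] h_approx[of "Suc (2 * m)" "Suc m" b] \<eta>_Suc[of m] by simp_all
    let ?hx = "h a \<otimes> ?x \<otimes> inv (h a)" and ?hy = "h b \<otimes> ?y \<otimes> inv (h b)"
    have hG: "?hx \<in> carrier G" "?hy \<in> carrier G" using h(1) x y by simp_all
    have "d ?hx ?hy \<le> d ?hx (c a (Suc m) ?x) + d (c a (Suc m) ?x) ?hy"
      by (rule d.triangle[OF hG(1) c_mem[OF x] hG(2)])
    also have "d (c a (Suc m) ?x) ?hy \<le> d (c a (Suc m) ?x) (c b (Suc m) ?y) + d (c b (Suc m) ?y) ?hy"
      by (rule d.triangle[OF c_mem[OF x] c_mem[OF y] hG(2)])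
    finally have "d ?hx ?hy < \<epsilon> m"
      using 1 2 3 \<eta>_le[of m] d.commute[of ?hx "c a (Suc m) ?x"] by linarith
    then show "\<exists>x\<in>X m. \<exists>y\<in>Y m. d (h a \<otimes> x \<otimes> inv (h a)) (h b \<otimes> y \<otimes> inv (h b)) < \<epsilon> m"
      using Q(4,5) by blast
  qed
qed

end

section \<open>Cylinders and category in the Cantor space\<close>

lemma cylinder_subset_open:
  assumes "openin cantor_space W" "a \<in> W"
  obtains m where "{b. \<forall>i<m. b i = a i} \<subseteq> W"
proof -
  have "\<exists>V. finite {i \<in> UNIV. V i \<noteq> topspace (discrete_topology UNIV)}
      \<and> (\<forall>i\<in>UNIV. openin (discrete_topology UNIV) (V i)) \<and> a \<in> PiE UNIV V \<and> PiE UNIV V \<subseteq> W"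
    using assms unfolding openin_product_topology_alt by blast
  then obtain V :: "nat \<Rightarrow> bool set" where V: "finite {i. V i \<noteq> UNIV}" "a \<in> PiE UNIV V" "PiE UNIV V \<subseteq> W"
    by auto
  obtain m where m: "\<And>i. V i \<noteq> UNIV \<Longrightarrow> i < m"
    using V(1) finite_nat_bounded[of "{i. V i \<noteq> UNIV}"] by blast
  have "{b. \<forall>i<m. b i = a i} \<subseteq> PiE UNIV V"
  proof clarify
    fix b assume b: "\<forall>i<m. b i = a i"
    have "b i \<in> V i" for i
    proof (cases "i < m")
      case True
      then show ?thesis using b PiE_mem[OF V(2), of i] by simp
    next
      case False
      then have "V i = UNIV" using m[of i] by blast
      then show ?thesis by simp
    qed
    then show "b \<in> PiE UNIV V" by auto
  qed
  then have "{b. \<forall>i<m. b i = a i} \<subseteq> W" using V(3) by (rule order_trans)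
  then show ?thesis by (rule that)
qed

lemma openin_cylinder: "openin cantor_space {b. \<forall>i<m. b i = a i}"
proof -
  have "{b. \<forall>i<m. b i = a i} = PiE UNIV (\<lambda>i. if i < m then {a i} else UNIV)"
    by (auto simp: PiE_UNIV_domain split: if_splits)
  moreover have "finite {i :: nat. (if i < m then {a i} else UNIV) \<noteq> (UNIV :: bool set)}"
    by (rule finite_subset[of _ "{..<m}"]) auto
  ultimately show ?thesis by (simp add: openin_PiE_gen)
qed

lemma has_countable_pi_base_cantor: "has_countable_pi_base cantor_space"
proof (rule has_countable_pi_baseI)
  let ?\<B> = "range (\<lambda>l :: bool list. {b :: nat \<Rightarrow> bool. \<forall>i<length l. b i = l ! i})"
  show "countable ?\<B>" by simp
  show "openin cantor_space V \<and> V \<noteq> {}" if V: "V \<in> ?\<B>" for V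
  proof -
    obtain l :: "bool list" where l: "V = {b. \<forall>i<length l. b i = l ! i}" using V by blast
    have "(\<lambda>i. l ! i) \<in> V" unfolding l by simp
    then show ?thesis using openin_cylinder[of "length l" "\<lambda>i. l ! i"] unfolding l by blast
  qed
  show "\<exists>V\<in>?\<B>. V \<subseteq> W" if W: "openin cantor_space W" "W \<noteq> {}" for W
  proof -
    obtain a where "a \<in> W" using W(2) by blast
    then obtain m where m: "{b. \<forall>i<m. b i = a i} \<subseteq> W" using cylinder_subset_open[OF W(1)] by blast
    have "{b. \<forall>i<length (map a [0..<m]). b i = map a [0..<m] ! i} \<subseteq> W" using m by simp
    then show ?thesis by (rule bexI) (rule rangeI)
  qed
qed

lemma completely_metrizable_cantor: "completely_metrizable_space cantor_space"
  unfolding completely_metrizable_space_product_topology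
  by (simp add: completely_metrizable_space_discrete_topology)

section \<open>Translations of a Polish group\<close>

context polish_group
begin

lemma homeomorphic_map_left_translation:
  assumes "g \<in> carrier G" shows "homeomorphic_map T T (\<lambda>x. g \<otimes> x)"
proof -
  have "continuous_map T T (\<lambda>x. u \<otimes> x)" if "u \<in> carrier G" for u
    using that by (intro continuous_mult) simp_all
  then have "homeomorphic_maps T T (\<lambda>x. g \<otimes> x) (\<lambda>x. inv g \<otimes> x)"
    unfolding homeomorphic_maps_def using assms by (simp add: m_assoc[symmetric])
  then show ?thesis by (rule homeomorphic_maps_imp_map)
qed

lemma homeomorphic_map_right_translation:
  assumes "g \<in> carrier G" shows "homeomorphic_map T T (\<lambda>x. x \<otimes> g)"
proof -
  have "continuous_map T T (\<lambda>x. x \<otimes> u)" if "u \<in> carrier G" for u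
    using that by (intro continuous_mult) simp_all
  then have "homeomorphic_maps T T (\<lambda>x. x \<otimes> g) (\<lambda>x. x \<otimes> inv g)"
    unfolding homeomorphic_maps_def using assms by (simp add: m_assoc)
  then show ?thesis by (rule homeomorphic_maps_imp_map)
qed

lemma not_meagre_carrier: "\<not> meagre_in T (carrier G)"
  using meagre_interior_empty[OF completely_metrizable_T, of "carrier G"] one_closed
  by (metis empty_iff interior_of_topspace topspace_T)

text \<open>The image of \<open>h\<close> may be meagre and miss \<open>C\<close> altogether. For
  fixed \<open>a\<close>, however, the elements \<open>g\<close> with
  \<open>g \<otimes> h a \<in> C\<close> form a right translate of \<open>C\<close>, hence a
  comeagre set, and Kuratowski-Ulam exchanges the roles of \<open>g\<close> and
  \<open>a\<close>.\<close>

lemma comeagre_translate_of_cantor: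
  assumes C: "comeagre_in T C" and h: "continuous_map cantor_space T h"
  obtains g where "g \<in> carrier G" "comeagre_in cantor_space {a. g \<otimes> h a \<in> C}"
proof -
  let ?P = "prod_topology T cantor_space"
  have hG: "h a \<in> carrier G" for a using h by (auto simp: continuous_map_def)
  obtain D :: "nat \<Rightarrow> 'a set" where D: "\<And>i. openin T (D i)" "\<And>i. T closure_of D i = topspace T"
    "topspace T \<inter> (\<Inter>i. D i) \<subseteq> C"
    using C unfolding comeagre_in_iff_dense_open by blast
  define E where "E i = {p \<in> topspace ?P. fst p \<otimes> h (snd p) \<in> D i}" for i
  have "continuous_map ?P T (\<lambda>p. h (snd p))"
    using continuous_map_compose[OF continuous_map_snd h] by (simp add: o_def)
  then have "continuous_map ?P T (\<lambda>p. fst p \<otimes> h (snd p))"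
    by (rule continuous_mult[OF continuous_map_fst])
  then have E_open: "openin ?P (E i)" for i
    unfolding E_def using D(1) by (rule openin_continuous_map_preimage)
  have "?P closure_of E i = topspace ?P" for i
    unfolding dense_intersects_open
  proof clarify
    fix W assume W: "openin ?P W" "W \<noteq> {}" "E i \<inter> W = {}"
    obtain g a where ga: "(g, a) \<in> W" using W(2) by auto
    \<comment> \<open>Density of \<open>E i\<close> is checked on the slice with second coordinate
      \<open>a\<close>, where it is the density of a right translate of \<open>D i\<close>.\<close>
    define V where "V = {x \<in> topspace T. (x, a) \<in> W}"
    have "continuous_map T ?P (\<lambda>x. (x, a))" by (intro continuous_map_pairedI) simp_all
    then have V: "openin T V" unfolding V_def using W(1) by (rule openin_continuous_map_preimage)
    have gV: "g \<in> V" using ga openin_subset[OF W(1)] unfolding V_def by auto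
    have "openin T ((\<lambda>x. x \<otimes> h a) ` V)"
      using homeomorphic_imp_open_map[OF homeomorphic_map_right_translation[OF hG]] V
      unfolding open_map_def by blast
    then have "D i \<inter> (\<lambda>x. x \<otimes> h a) ` V \<noteq> {}"
      using D(2)[of i] gV unfolding dense_intersects_open by blast
    then obtain x where "x \<in> V" "x \<otimes> h a \<in> D i" by blast
    then have "(x, a) \<in> E i \<inter> W" unfolding V_def E_def by simp
    then show False using W(3) by blast
  qed
  then have "comeagre_in ?P (topspace ?P \<inter> (\<Inter>i. E i))"
    by (intro comeagre_in_INT) (auto intro: comeagre_in_dense_open[OF E_open])
  then have *: "comeagre_in T {g \<in> topspace T. comeagre_in cantor_space {a \<in> topspace cantor_space. (g, a) \<in> topspace ?P \<inter> (\<Inter>i. E i)}}"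
    by (rule Kuratowski_Ulam[OF has_countable_pi_base_cantor])
  have "openin T (carrier G)" "carrier G \<noteq> {}" using openin_topspace[of T] by auto
  from comeagre_meets_open[OF completely_metrizable_T * this]
  obtain g where g: "g \<in> carrier G"
    "comeagre_in cantor_space {a \<in> topspace cantor_space. (g, a) \<in> topspace ?P \<inter> (\<Inter>i. E i)}"
    by blast
  have "g \<otimes> h a \<in> C" if "(g, a) \<in> (\<Inter>i. E i)" for a
  proof -
    have "g \<otimes> h a \<in> D i" for i using that unfolding E_def by auto
    then show ?thesis using D(3) g(1) hG by auto
  qed
  then have "comeagre_in cantor_space {a. g \<otimes> h a \<in> C}"
    by (intro comeagre_in_superset[OF g(2)]) auto
  then show ?thesis using that g(1) by blast
qed

lemma set_mult_memI: "x \<in> A \<Longrightarrow> y \<in> B \<Longrightarrow> x \<otimes> y \<in> A <#> B"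
  unfolding set_mult_def by blast

lemma set_inv_memI: "x \<in> A \<Longrightarrow> inv x \<in> set_inv A"
  unfolding SET_INV_def by blast

end

section \<open>The tenfold product and the final contradiction\<close>

abbreviation (in group) ten_fold :: "'a set \<Rightarrow> 'a set" where
  "ten_fold A \<equiv> set_inv A <#> A <#> set_inv A <#> set_inv A <#> A <#> set_inv A
        <#> A <#> A <#> set_inv A <#> A"

context topometric_group
begin

text \<open>The conjugate of \<open>x\<close> by \<open>inv b \<otimes> a\<close>, preceded by
  \<open>inv c\<close>, is a word of six letters. Inserting \<open>c \<otimes> inv c\<close> after
  the first letter and \<open>inv c \<otimes> c\<close> before \<open>x\<close> gives exactly the
  required pattern of ten.\<close>

lemma conj_mem_ten_fold:
  assumes A: "A \<subseteq> carrier G" and mem: "a \<in> A" "b \<in> A" "c \<in> A" "x \<in> A"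
  shows "inv c \<otimes> (inv b \<otimes> a \<otimes> x \<otimes> (inv a \<otimes> b)) \<in> ten_fold A"
proof -
  have G: "a \<in> carrier G" "b \<in> carrier G" "c \<in> carrier G" "x \<in> carrier G" using A mem by auto
  have "inv c \<otimes> c \<otimes> inv c \<otimes> inv b \<otimes> a \<otimes> inv c \<otimes> c \<otimes> x \<otimes> inv a \<otimes> b \<in> ten_fold A"
    by (intro set_mult_memI set_inv_memI mem)
  also have "inv c \<otimes> c \<otimes> inv c \<otimes> inv b \<otimes> a \<otimes> inv c \<otimes> c \<otimes> x \<otimes> inv a \<otimes> b
     = inv c \<otimes> (inv b \<otimes> a \<otimes> x \<otimes> (inv a \<otimes> b))"
    using G by (simp add: m_assoc inv_solve_left)
  finally show ?thesis .
qed

text \<open>If \<open>g\<close> is near the identity but far from the tenfold product, then \<open>A g\<close> is far from the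
  conjugates in question, and it is nonmeagre almost wherever \<open>A\<close> is.\<close>

lemma nonmeagre_far_from_conjugates:
  assumes A: "A \<subseteq> carrier G" and U: "\<And>V. openin T V \<Longrightarrow> V \<noteq> {} \<Longrightarrow> V \<subseteq> U \<Longrightarrow> \<not> meagre_in T (A \<inter> V)"
    and one: "\<one> \<notin> T interior_of eps_nbhd (carrier G) d (ten_fold A) e"
    and V: "openin T V" "V \<noteq> {}" "V \<subseteq> U"
  shows "\<not> meagre_in T ({y \<in> carrier G. \<forall>a\<in>A. \<forall>b\<in>A. \<forall>x\<in>A. e \<le> d (inv b \<otimes> a \<otimes> x \<otimes> (inv a \<otimes> b)) y} \<inter> V)"
    (is "\<not> meagre_in T (?Y \<inter> V)")
proof
  assume meagre: "meagre_in T (?Y \<inter> V)"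
  obtain u where u: "u \<in> V" "u \<in> carrier G" using V(2) openin_subset[OF V(1)] by auto
  have id: "continuous_map T T (\<lambda>k. k)" by simp
  have "continuous_map T T (\<lambda>k. u)" using u by simp
  then have "continuous_map T T (\<lambda>g. u \<otimes> inv g)" by (rule continuous_mult[OF _ continuous_inv[OF id]])
  then have N: "openin T {g \<in> topspace T. u \<otimes> inv g \<in> V}" using V(1) by (rule openin_continuous_map_preimage)
  have "\<one> \<in> {g \<in> topspace T. u \<otimes> inv g \<in> V}" using u by simp
  \<comment> \<open>The product fails on every neighbourhood of \<open>\<one>\<close>, in particular
    on the one where \<open>u \<otimes> inv g\<close> stays in \<open>V\<close>; this choice makes
    \<open>?V'\<close> below nonempty.\<close>
  then have "\<not> {g \<in> topspace T. u \<otimes> inv g \<in> V} \<subseteq> eps_nbhd (carrier G) d (ten_fold A) e"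
    using one interior_of_maximal[OF _ N] by blast
  then obtain g where g: "g \<in> carrier G" "u \<otimes> inv g \<in> V" "g \<notin> eps_nbhd (carrier G) d (ten_fold A) e"
    by auto
  have far: "e \<le> d w g" if "w \<in> ten_fold A" for w
    using g(1,3) that d.commute[of w g] unfolding eps_nbhd_def by force
  let ?V' = "V \<inter> {v \<in> topspace T. v \<otimes> g \<in> V}"
  have "openin T {v \<in> topspace T. v \<otimes> g \<in> V}"
    by (rule openin_continuous_map_preimage[OF homeomorphic_imp_continuous_map[OF homeomorphic_map_right_translation[OF g(1)]] V(1)])
  then have V': "openin T ?V'" using V(1) by (rule openin_Int[rotated])
  have "u \<otimes> inv g \<in> ?V'" using g u by (simp add: m_assoc)
  then have nm: "\<not> meagre_in T (A \<inter> ?V')" using U[OF V'] V(3) by blast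
  have "(\<lambda>x. x \<otimes> g) ` (A \<inter> ?V') \<subseteq> ?Y \<inter> V"
  proof (rule image_subsetI)
    fix c assume "c \<in> A \<inter> ?V'"
    then have c: "c \<in> A" "c \<in> V" "c \<in> carrier G" "c \<otimes> g \<in> V" by auto
    have "e \<le> d (inv b \<otimes> a \<otimes> x \<otimes> (inv a \<otimes> b)) (c \<otimes> g)" if "a \<in> A" "b \<in> A" "x \<in> A" for a b x
    proof -
      let ?p = "inv b \<otimes> a \<otimes> x \<otimes> (inv a \<otimes> b)"
      have G: "a \<in> carrier G" "b \<in> carrier G" "c \<in> carrier G" "x \<in> carrier G" using A that c(1) by auto
      then have p: "?p \<in> carrier G" by simp
      \<comment> \<open>Left invariance turns this into the distance of \<open>g\<close> from
        \<open>inv c \<otimes> ?p\<close>; the leading \<open>inv c\<close> of the tenfold word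
        comes from here.\<close>
      have "d ?p (c \<otimes> g) = d (inv c \<otimes> ?p) (inv c \<otimes> (c \<otimes> g))"
        by (rule d_left_invariant[symmetric]) (use G p g(1) in simp_all)
      also have "inv c \<otimes> (c \<otimes> g) = g" using G(3) g(1) by (simp add: m_assoc[symmetric])
      finally show ?thesis using far[OF conj_mem_ten_fold[OF A that(1,2) c(1) that(3)]] by simp
    qed
    then show "c \<otimes> g \<in> ?Y \<inter> V" using c g(1) by simp
  qed
  then have "meagre_in T ((\<lambda>x. x \<otimes> g) ` (A \<inter> ?V'))" using meagre meagre_in_subset by blast
  moreover have "(\<lambda>x. x \<otimes> g) ` (A \<inter> ?V') \<subseteq> topspace T" using A g(1) by auto
  ultimately have "meagre_in T ((\<lambda>x. x \<otimes> inv g) ` (\<lambda>x. x \<otimes> g) ` (A \<inter> ?V'))"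
    by (rule meagre_in_homeomorphic_image[OF homeomorphic_map_right_translation[OF inv_closed[OF g(1)]]])
  moreover have "(\<lambda>x. x \<otimes> inv g) ` (\<lambda>x. x \<otimes> g) ` (A \<inter> ?V') = A \<inter> ?V'"
  proof -
    have "c \<otimes> g \<otimes> inv g = c" if "c \<in> A \<inter> ?V'" for c
      using that A g(1) by (simp add: m_assoc subsetD)
    then have "(\<lambda>x. x \<otimes> g \<otimes> inv g) ` (A \<inter> ?V') = id ` (A \<inter> ?V')"
      by (intro image_cong) auto
    then show ?thesis unfolding image_image by (simp only: image_id id_apply)
  qed
  ultimately show False using nm by simp
qed

lemma comeagre_orbits_of_ample_generics:
  assumes "ample_generics G T d"
  shows "comeagre_in (tuples_top T n)
    (isometric_action.locally_nonmeagre_orbits G T (tuples_top T n) (sup_dist d n) (conj_tuple n))"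
proof (rule isometric_action.comeagre_locally_nonmeagre_orbits[OF isometric_action_tuples has_countable_pi_base_tuples])
  fix \<epsilon> :: real assume "0 < \<epsilon>"
  then obtain g where g: "g \<in> topspace (tuples_top T n)"
    "comeagre_in (tuples_top T n) (eps_nbhd (topspace (tuples_top T n)) (sup_dist d n) (conj_orbit G n g) \<epsilon>)"
    using assms unfolding ample_generics_def by blast
  have "eps_nbhd (topspace (tuples_top T n)) (sup_dist d n) (conj_orbit G n g) \<epsilon>
     = {z \<in> topspace (tuples_top T n). \<exists>k\<in>carrier G. sup_dist d n z (conj_tuple n k g) < \<epsilon>}"
    unfolding eps_nbhd_def conj_orbit_def conj_tuple_def by blast
  then show "\<exists>g\<in>topspace (tuples_top T n). comeagre_in (tuples_top T n)
      {z \<in> topspace (tuples_top T n). \<exists>k\<in>carrier G. sup_dist d n z (conj_tuple n k g) < \<epsilon>}"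
    using g by auto
qed

lemma comeagre_nonmeagre_translates:
  fixes k :: "nat \<Rightarrow> 'a"
  assumes k: "\<And>n. k n \<in> carrier G" and A: "\<And>n. A n \<subseteq> carrier G"
    and C: "comeagre_in T (\<Union>n. k n <# A n)"
  shows "comeagre_in T (\<Union>n\<in>{n. \<not> meagre_in T (A n)}. k n <# A n)"
  unfolding comeagre_in_def
proof
  show "(\<Union>n\<in>{n. \<not> meagre_in T (A n)}. k n <# A n) \<subseteq> topspace T"
    using C unfolding comeagre_in_def by blast
  have "meagre_in T (k n <# A n)" if "meagre_in T (A n)" for n
  proof -
    have "k n <# A n = (\<lambda>x. k n \<otimes> x) ` A n" unfolding l_coset_def by blast
    then show ?thesis
      using meagre_in_homeomorphic_image[OF homeomorphic_map_left_translation[OF k] that] A by simp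
  qed
  then have "meagre_in T (\<Union>n\<in>{n. meagre_in T (A n)}. k n <# A n)"
    by (intro meagre_in_UN) auto
  then have "meagre_in T ((topspace T - (\<Union>n. k n <# A n)) \<union> (\<Union>n\<in>{n. meagre_in T (A n)}. k n <# A n))"
    using C unfolding comeagre_in_def by (intro meagre_in_Un) auto
  then show "meagre_in T (topspace T - (\<Union>n\<in>{n. \<not> meagre_in T (A n)}. k n <# A n))"
    by (rule meagre_in_subset) blast
qed

lemma ten_fold_neighbourhood:
  fixes k :: "nat \<Rightarrow> 'a"
  assumes ample: "ample_generics G T d"
    and k: "\<And>n. k n \<in> carrier G" and A: "\<And>n. A n \<subseteq> carrier G"
    and C: "comeagre_in T (\<Union>n. k n <# A n)"
  shows "\<exists>n. \<forall>e>0. \<one> \<in> T interior_of eps_nbhd (carrier G) d (ten_fold (A n)) e"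
proof (rule ccontr)
  assume "\<nexists>n. \<forall>e>0. \<one> \<in> T interior_of eps_nbhd (carrier G) d (ten_fold (A n)) e"
  then obtain e where e: "\<And>n. 0 < e n"
    "\<And>n. \<one> \<notin> T interior_of eps_nbhd (carrier G) d (ten_fold (A n)) (e n)"
    by metis
  define I where "I = {n. \<not> meagre_in T (A n)}"
  have C': "comeagre_in T (\<Union>n\<in>I. k n <# A n)"
    unfolding I_def by (rule comeagre_nonmeagre_translates[OF k A C])
  have "I \<noteq> {}" using C' not_meagre_carrier unfolding comeagre_in_def by auto
  then obtain n0 where n0: "n0 \<in> I" by blast
  \<comment> \<open>The second component of the decoded pair is arbitrary, so each index of
    \<open>I\<close> recurs at arbitrarily high levels. The default \<open>n0\<close> ensures that
    every level works with a nonmeagre set.\<close>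
  define \<sigma> where "\<sigma> m = (let n = fst (prod_decode m) in if n \<in> I then n else n0)" for m
  have \<sigma>_I: "\<sigma> m \<in> I" for m using n0 by (simp add: \<sigma>_def Let_def)
  have \<sigma>_inf: "\<exists>m\<ge>l. \<sigma> m = n" if "n \<in> I" for n l
    using that by (intro exI[of _ "prod_encode (n, l)"]) (simp add: \<sigma>_def le_prod_encode_2)
  have "\<exists>U. openin T U \<and> meagre_in T (A n - U) \<and>
       (\<forall>V. openin T V \<longrightarrow> V \<noteq> {} \<longrightarrow> V \<subseteq> U \<longrightarrow> \<not> meagre_in T (A n \<inter> V))" for n
    by (rule nonmeagre_locus[OF has_countable_pi_base_T, of "A n"]) (use A in auto)
  then obtain U where U: "\<And>n. openin T (U n)" "\<And>n. meagre_in T (A n - U n)"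
       "\<And>n V. openin T V \<Longrightarrow> V \<noteq> {} \<Longrightarrow> V \<subseteq> U n \<Longrightarrow> \<not> meagre_in T (A n \<inter> V)"
    by metis
  have AU: "\<not> meagre_in T (A n \<inter> U n)" if "n \<in> I" for n
  proof
    assume "meagre_in T (A n \<inter> U n)"
    then have "meagre_in T ((A n \<inter> U n) \<union> (A n - U n))" using U(2) by (rule meagre_in_Un)
    then show False using that unfolding I_def by (simp add: Int_Diff_Un)
  qed
  define Y where "Y n = {y \<in> carrier G. \<forall>a\<in>A n. \<forall>b\<in>A n. \<forall>x\<in>A n. e n \<le> d (inv b \<otimes> a \<otimes> x \<otimes> (inv a \<otimes> b)) y}" for n
  have Y: "\<not> meagre_in T (Y n \<inter> V)" if "openin T V" "V \<noteq> {}" "V \<subseteq> U n" for n V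
    unfolding Y_def by (rule nonmeagre_far_from_conjugates[OF A U(3) e(2) that])
  obtain S where S: "hereditarily_comeagre S"
    "\<And>n. S n \<subseteq> isometric_action.locally_nonmeagre_orbits G T (tuples_top T n) (sup_dist d n) (conj_tuple n)"
    using hereditarily_comeagre_subset[OF comeagre_orbits_of_ample_generics[OF ample]] by metis
  obtain h where h: "continuous_map cantor_space T h"
    "\<And>m a b. (\<And>i. i < m \<Longrightarrow> a i = b i) \<Longrightarrow> a m \<Longrightarrow> \<not> b m \<Longrightarrow>
       \<exists>x\<in>A (\<sigma> m). \<exists>y\<in>Y (\<sigma> m). d (h a \<otimes> x \<otimes> inv (h a)) (h b \<otimes> y \<otimes> inv (h b)) < e (\<sigma> m)"
  proof (rule Cantor_scheme[OF S, of "\<lambda>m. U (\<sigma> m)" "\<lambda>m. A (\<sigma> m)" "\<lambda>m. Y (\<sigma> m)" "\<lambda>m. e (\<sigma> m)"])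
    show "Y (\<sigma> m) \<subseteq> carrier G" for m unfolding Y_def by blast
  qed (use A AU[OF \<sigma>_I] U(1) Y e(1) in auto)
  have hG: "h a \<in> carrier G" for a using h(1) by (auto simp: continuous_map_def)
  obtain g where g: "g \<in> carrier G" "comeagre_in cantor_space {a. g \<otimes> h a \<in> (\<Union>n\<in>I. k n <# A n)}"
    by (rule comeagre_translate_of_cantor[OF C' h(1)])
  define R where "R n = {a. g \<otimes> h a \<in> k n <# A n}" for n
  \<comment> \<open>Density in some cylinder is all that is asked of \<open>R n\<close>, which may
    lack the Baire property like \<open>A n\<close>: two of its elements with a prescribed splitting
    level are enough.\<close>
  have "\<exists>n\<in>I. \<not> nowhere_dense_in cantor_space (R n)"
  proof (rule ccontr)
    assume "\<not> (\<exists>n\<in>I. \<not> nowhere_dense_in cantor_space (R n))"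
    then have "meagre_in cantor_space (\<Union>n\<in>I. R n)"
      by (intro meagre_in_UN nowhere_dense_imp_meagre) auto
    moreover have "{a. g \<otimes> h a \<in> (\<Union>n\<in>I. k n <# A n)} = (\<Union>n\<in>I. R n)" unfolding R_def by blast
    moreover have "meagre_in cantor_space (topspace cantor_space - {a. g \<otimes> h a \<in> (\<Union>n\<in>I. k n <# A n)})"
      using g(2) unfolding comeagre_in_def by blast
    ultimately have "meagre_in cantor_space ((\<Union>n\<in>I. R n) \<union> (topspace cantor_space - (\<Union>n\<in>I. R n)))"
      by (simp only: meagre_in_Un)
    then have "meagre_in cantor_space (topspace cantor_space)" by (rule meagre_in_subset) blast
    then have "cantor_space interior_of topspace cantor_space = {}"
      by (rule meagre_interior_empty[OF completely_metrizable_cantor])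
    then show False by (simp only: interior_of_topspace) simp
  qed
  then obtain n where n: "n \<in> I" "cantor_space interior_of (cantor_space closure_of (R n)) \<noteq> {}"
    unfolding nowhere_dense_in_def by blast
  then obtain a0 where "a0 \<in> cantor_space interior_of (cantor_space closure_of (R n))" by blast
  then obtain l where "{b. \<forall>i<l. b i = a0 i} \<subseteq> cantor_space interior_of (cantor_space closure_of (R n))"
    by (rule cylinder_subset_open[OF openin_interior_of])
  then have l: "{b. \<forall>i<l. b i = a0 i} \<subseteq> cantor_space closure_of (R n)"
    using interior_of_subset by (rule order_trans)
  \<comment> \<open>As \<open>l \<le> m\<close>, the set \<open>R n\<close> is dense in the cylinder
    given by the first \<open>m\<close> values of \<open>a0\<close>, hence meets both of its halves
    at level \<open>m\<close>.\<close>
  obtain m where m: "l \<le> m" "\<sigma> m = n" using \<sigma>_inf[OF n(1)] by blast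
  have "\<exists>a\<in>R n. (\<forall>i<m. a i = a0 i) \<and> a m = c" for c
  proof -
    let ?V = "{b. \<forall>i<Suc m. b i = (a0(m := c)) i}"
    have "a0(m := c) \<in> ?V" by simp
    moreover have "a0(m := c) \<in> cantor_space closure_of (R n)" using l m(1) by auto
    ultimately obtain a where "a \<in> R n" "a \<in> ?V"
      using openin_cylinder[of "Suc m" "a0(m := c)"] unfolding in_closure_of by meson
    then show ?thesis by (intro bexI[of _ a]) auto
  qed
  then obtain a b where ab: "a \<in> R n" "b \<in> R n" "\<And>i. i < m \<Longrightarrow> a i = b i" "a m" "\<not> b m"
    by metis
  obtain x y where xy: "x \<in> A n" "y \<in> Y n" "d (h a \<otimes> x \<otimes> inv (h a)) (h b \<otimes> y \<otimes> inv (h b)) < e n"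
    using h(2)[of m a b, OF ab(3-5)] unfolding m(2) by blast
  obtain \<alpha> \<beta> where \<alpha>: "\<alpha> \<in> A n" "g \<otimes> h a = k n \<otimes> \<alpha>" and \<beta>: "\<beta> \<in> A n" "g \<otimes> h b = k n \<otimes> \<beta>"
    using ab(1,2) unfolding R_def l_coset_def by blast
  have G: "\<alpha> \<in> carrier G" "\<beta> \<in> carrier G" "x \<in> carrier G" "y \<in> carrier G" "k n \<in> carrier G"
    using \<alpha>(1) \<beta>(1) xy(1,2) A k unfolding Y_def by auto
  define v where "v = inv \<beta> \<otimes> \<alpha>"
  have v: "v \<in> carrier G" "inv v = inv \<alpha> \<otimes> \<beta>" using G by (simp_all add: v_def inv_mult_group)
  have "\<beta> \<otimes> v = \<alpha>" using G by (simp add: v_def m_assoc[symmetric])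
  then have "g \<otimes> (h b \<otimes> v) = g \<otimes> h a"
    using \<alpha>(2) \<beta>(2) G g(1) hG v(1) by (metis m_assoc)
  then have "h a = h b \<otimes> v" using g(1) hG v(1) by simp
  then have "h a \<otimes> x \<otimes> inv (h a) = h b \<otimes> (v \<otimes> x \<otimes> inv v) \<otimes> inv (h b)"
    using hG v(1) G by (simp add: inv_mult_group m_assoc)
  then have "d (h a \<otimes> x \<otimes> inv (h a)) (h b \<otimes> y \<otimes> inv (h b)) = d (v \<otimes> x \<otimes> inv v) y"
    using hG v(1) G by (simp add: d_invariant)
  then have "d (inv \<beta> \<otimes> \<alpha> \<otimes> x \<otimes> (inv \<alpha> \<otimes> \<beta>)) y < e n" using xy(3) v(2) unfolding v_def by simp
  moreover have "e n \<le> d (inv \<beta> \<otimes> \<alpha> \<otimes> x \<otimes> (inv \<alpha> \<otimes> \<beta>)) y"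
    using xy(1,2) \<alpha>(1) \<beta>(1) unfolding Y_def by blast
  ultimately show False by simp
qed

end

theorem theorem4p6:
  fixes G :: "('a, 'b) monoid_scheme" and T :: "'a topology" and d :: "'a \<Rightarrow> 'a \<Rightarrow> real"
    and k :: "nat \<Rightarrow> 'a" and A :: "nat \<Rightarrow> 'a set"
  assumes "Polish_topometric_group G T d"
    and "ample_generics G T d"
    and "\<And>n. k n \<in> carrier G"
    and "\<And>n. A n \<subseteq> carrier G"
    and "comeagre_in T (\<Union>n. k n <#\<^bsub>G\<^esub> A n)"
  shows "\<exists>n. \<forall>e>0. \<one>\<^bsub>G\<^esub> \<in> T interior_of
     (eps_nbhd (carrier G) d
       (set_inv\<^bsub>G\<^esub> (A n) <#>\<^bsub>G\<^esub> A n <#>\<^bsub>G\<^esub> set_inv\<^bsub>G\<^esub> (A n)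
        <#>\<^bsub>G\<^esub> set_inv\<^bsub>G\<^esub> (A n) <#>\<^bsub>G\<^esub> A n <#>\<^bsub>G\<^esub> set_inv\<^bsub>G\<^esub> (A n)
        <#>\<^bsub>G\<^esub> A n <#>\<^bsub>G\<^esub> A n <#>\<^bsub>G\<^esub> set_inv\<^bsub>G\<^esub> (A n) <#>\<^bsub>G\<^esub> A n) e)"
proof -
  have "topometric_group G T d"
    using assms(1)
    by (simp add: topometric_group_def topometric_group_axioms_def polish_group_def
        polish_group_axioms_def Polish_topometric_group_def Polish_group_def)
  from topometric_group.ten_fold_neighbourhood[OF this assms(2-5)] show ?thesis .
qed

end
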